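(* Let $\mu$ be the plate process on $Y$ with density $p(x)=c_\nu^{-1}\exp(\nu_1S(U_x)+\nu_2L(U_x)+\nu_3N(U_x))$ with respect to $P_\eta$, where $\nu_1\in\mathbb R$, $\nu_2\le0$, $\nu_3\le0$. Then $$\mathbb E S(U_\mu)=\int_Y\mathbb E[\mathcal E_\mu(y)]A(y)\,\lambda(dy),\quad \mathbb EL(U_\mu)=\tfrac12\int_{Y^2}\mathbb E[\mathcal E_\mu(y_1,y_2)]\,l(y_1\cap y_2)\,\lambda(d(y_1,y_2)),$$ $$\mathbb EN(U_\mu)=\tfrac16\int_{Y^3}\mathbb E[\mathcal E_\mu(y_1,y_2,y_3)]1_{[y_1\cap y_2\cap y_3\neq\emptyset]}\lambda(d(y_1,y_2,y_3)),$$ $$\mathbb E[S(U_\mu)^2]=\int_{Y^2}\mathbb E[\mathcal E_\mu(y_1,y_2)]A(y_1)A(y_2)\lambda(d(y_1,y_2))+\int_Y\mathbb E[\mathcal E_\mu(y)]A(y)^2\lambda(dy),$$ $$\mathbb E[L(U_\mu)^2]=\tfrac14\int_{Y^4}\mathbb E[\mathcal E_\mu(y_1,\dots,y_4)]l(y_1\cap y_2)l(y_3\cap y_4)\lambda(d(y_1,\dots,y_4))+\int_{Y^3}\mathbb E[\mathcal E_\mu(y_1,y_2,y_3)]l(y_1\cap y_2)l(y_3\cap y_1)\lambda(d(y_1,y_2,y_3))+\tfrac12\int_{Y^2}\mathbb E[\mathcal E_\mu(y_1,y_2)]l(y_1\cap y_2)^2\lambda(d(y_1,y_2)),$$ $$\mathbb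 E[N(U_\mu)^2]=\tfrac1{36}\int_{Y^6}\mathbb E[\mathcal E_\mu(y_1,\dots,y_6)]1_{[y_1\cap y_2\cap y_3\neq\emptyset]}1_{[y_4\cap y_5\cap y_6\neq\emptyset]}\lambda(d(y_1,\dots,y_6))+\tfrac14\int_{Y^5}\mathbb E[\mathcal E_\mu(y_1,\dots,y_5)]1_{[y_1\cap y_2\cap y_3\neq\emptyset]}1_{[y_4\cap y_5\cap y_1\neq\emptyset]}\lambda(d(y_1,\dots,y_5))$$ $$+\tfrac12\int_{Y^4}\mathbb E[\mathcal E_\mu(y_1,\dots,y_4)]1_{[y_1\cap y_2\cap y_3\neq\emptyset]}1_{[y_4\cap y_2\cap y_1\neq\emptyset]}\lambda(d(y_1,\dots,y_4))+\tfrac16\int_{Y^3}\mathbb E[\mathcal E_\mu(y_1,y_2,y_3)]1_{[y_1\cap y_2\cap y_3\neq\emptyset]}\lambda(d(y_1,y_2,y_3)).$$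
   Context: $B\subset\mathbb R^3$ is a bounded Borel set with positive volume, $b>0$, $\mathbb S^2$ the unit (upper) hemisphere, $Y=B\times(0,b]\times\mathbb S^2$; $y=(z,r,\phi)\in Y$ represents the closed disc in $\mathbb R^3$ with centre $z$, radius $r$, unit normal $\phi$. $\eta$ is a Poisson process on $Y$ with intensity measure $\lambda(d(z,r,\phi))=\rho(z)\,dz\,Q(dr)\,V(d\phi)$, $\rho$ bounded nonnegative on $B$, $Q,V$ probability measures; $\lambda(d(y_1,\dots,y_n))$ denotes $\lambda^n$. For a finite configuration $x$ of plates: $A(s)=\pi r^2$ the area of plate $s$, $l(s\cap t)$ the length of the intersection of plates $s,t$; $S(U_x)=\sum_{s\in x}A(s)$, $L(U_x)=\frac12\sum_{(s,t)\in x^2_{\neq}}l(s\cap t)$, $N(U_x)=\frac16\sum_{(s,t,u)\in x^3_{\neq}}1_{[s\cap t\cap u\neq\emptyset]}$ ($x^k_{\neq}$ = $k$-tuples of distinct plates of $x$); $G(U_x)=(S,L,N)(U_x)$, $\nu=(\nu_1,\nu_2,\nu_3)$, $c_\nu$ the normalizing constant. For $y,y_i\notin x$: $D_yG(U_x)=\big(A(y),\ \sum_{s\in x}l(s\cap y),\ \#\{\{s,t\}\subset x,\ s\neq t: s\cap t\cap y\neq\emptyset\}\big)$, $D^2_{y_1y_2}G(U_x)=\big(0,\ l(y_1\cap y_2),\ \sum_{s\in x}1_{[s\cap y_1\cap y_2\neq\emptyset]}\big)$, $D^3_{y_1y_2y_3}G(U_x)=(0,0,1_{[y_1\cap y_2\cap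 y_3\neq\emptyset]})$. $\mathcal E_x(y_1,\dots,y_m)=\exp(\nu\cdot Q_m)$, $Q_m=\sum_{i}D_{y_i}G(U_x)+\sum_{i<j}D^2_{y_iy_j}G(U_x)+\sum_{i<j<l}D^3_{y_iy_jy_l}G(U_x)$; $\mathcal E_\mu$ is this with $x=\mu$ (it equals the conditional intensity $\lambda^*_m(y_1,\dots,y_m,\mu)=p(\mu\cup\{y_1,\dots,y_m\})/p(\mu)$). *)

theory Defs
  imports "HOL-Probability.Probability"
begin

text \<open>A plate (z, r, phi): closed disc with centre z, radius r, unit normal phi.\<close>
type_synonym plate = "(real^3) \<times> real \<times> (real^3)"

definition disc :: "plate \<Rightarrow> (real^3) set" where
  "disc y = (case y of (z, r, phi) \<Rightarrow> {x. dist x z \<le> r \<and> (x - z) \<bullet> phi = 0})"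

definition area :: "plate \<Rightarrow> real" where
  "area y = pi * (fst (snd y))^2"

text \<open>Length of the intersection of two plates (a segment in the generic case),
  measured as its diameter.\<close>
definition ilen :: "plate \<Rightarrow> plate \<Rightarrow> real" where
  "ilen s t = diameter (disc s \<inter> disc t)"

definition meet3 :: "plate \<Rightarrow> plate \<Rightarrow> plate \<Rightarrow> real" where
  "meet3 s t u = (if disc s \<inter> disc t \<inter> disc u \<noteq> {} then 1 else 0)"

definition hemi :: "(real^3) set" where
  "hemi = {phi. norm phi = 1 \<and> phi $ 3 \<ge> 0}"

definition plate_space :: "(real^3) set \<Rightarrow> real \<Rightarrow> plate set" where
  "plate_space B b = B \<times> {0<..b} \<times> hemi"

definition plate_intensity ::
  "(real^3) set \<Rightarrow> real \<Rightarrow> (real^3 \<Rightarrow> real) \<Rightarrow> real measure \<Rightarrow> (real^3) measure \<Rightarrow> plate measure" where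
  "plate_intensity B b rho Q V =
     density (lborel \<Otimes>\<^sub>M (Q \<Otimes>\<^sub>M V))
       (\<lambda>(z, r, phi). indicator (plate_space B b) (z, r, phi) * ennreal (rho z))"

text \<open>Finite configurations are lists of plates (counting measures with
  multiplicity); all functionals below are symmetric in the order.\<close>

definition dpairs :: "nat \<Rightarrow> (nat \<times> nat) set" where
  "dpairs n = {(i, j). i < n \<and> j < n \<and> i \<noteq> j}"

definition dtriples :: "nat \<Rightarrow> (nat \<times> nat \<times> nat) set" where
  "dtriples n = {(i, j, k). i < n \<and> j < n \<and> k < n \<and> i \<noteq> j \<and> i \<noteq> k \<and> j \<noteq> k}"

definition S_cfg :: "plate list \<Rightarrow> real" where
  "S_cfg x = (\<Sum>i<length x. area (x ! i))"

definition L_cfg :: "plate list \<Rightarrow> real" where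
  "L_cfg x = 1/2 * (\<Sum>(i, j)\<in>dpairs (length x). ilen (x ! i) (x ! j))"

definition N_cfg :: "plate list \<Rightarrow> real" where
  "N_cfg x = 1/6 * (\<Sum>(i, j, k)\<in>dtriples (length x). meet3 (x ! i) (x ! j) (x ! k))"

text \<open>Expectation w.r.t. the law of a Poisson process with finite intensity measure lam:
  E F(eta) = exp(-lam(Y)) * sum_n 1/n! * int_{Y^n} F(y_1..y_n) lam^n(dy).\<close>
definition pp_exp :: "plate measure \<Rightarrow> (plate list \<Rightarrow> ennreal) \<Rightarrow> ennreal" where
  "pp_exp lam F = ennreal (exp (- measure lam (space lam))) *
     (\<Sum>n. ennreal (1 / fact n) *
        (\<integral>\<^sup>+ y. F (map y [0..<n]) \<partial>(PiM {..<n} (\<lambda>_. lam))))"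

definition hamil :: "real \<Rightarrow> real \<Rightarrow> real \<Rightarrow> plate list \<Rightarrow> real" where
  "hamil nu1 nu2 nu3 x = nu1 * S_cfg x + nu2 * L_cfg x + nu3 * N_cfg x"

definition cnu :: "plate measure \<Rightarrow> real \<Rightarrow> real \<Rightarrow> real \<Rightarrow> ennreal" where
  "cnu lam nu1 nu2 nu3 = pp_exp lam (\<lambda>x. ennreal (exp (hamil nu1 nu2 nu3 x)))"

definition gibbs_exp ::
  "plate measure \<Rightarrow> real \<Rightarrow> real \<Rightarrow> real \<Rightarrow> (plate list \<Rightarrow> ennreal) \<Rightarrow> ennreal" where
  "gibbs_exp lam nu1 nu2 nu3 f =
     pp_exp lam (\<lambda>x. ennreal (exp (hamil nu1 nu2 nu3 x)) / cnu lam nu1 nu2 nu3 * f x)"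

text \<open>Difference operators of G(U_x) = (S, L, N)(U_x).\<close>
definition D1 :: "plate list \<Rightarrow> plate \<Rightarrow> real \<times> real \<times> real" where
  "D1 x y = (area y, (\<Sum>s\<leftarrow>x. ilen s y),
     (\<Sum>(i, j)\<in>{(i, j). i < j \<and> j < length x}. meet3 (x ! i) (x ! j) y))"

definition D2 :: "plate list \<Rightarrow> plate \<Rightarrow> plate \<Rightarrow> real \<times> real \<times> real" where
  "D2 x y1 y2 = (0, ilen y1 y2, (\<Sum>s\<leftarrow>x. meet3 s y1 y2))"

definition D3 :: "plate \<Rightarrow> plate \<Rightarrow> plate \<Rightarrow> real \<times> real \<times> real" where
  "D3 y1 y2 y3 = (0, 0, meet3 y1 y2 y3)"

definition Qm :: "plate list \<Rightarrow> plate list \<Rightarrow> real \<times> real \<times> real" where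
  "Qm x ys =
     (\<Sum>i<length ys. D1 x (ys ! i))
   + (\<Sum>(i, j)\<in>{(i, j). i < j \<and> j < length ys}. D2 x (ys ! i) (ys ! j))
   + (\<Sum>(i, j, k)\<in>{(i, j, k). i < j \<and> j < k \<and> k < length ys}. D3 (ys ! i) (ys ! j) (ys ! k))"

definition Ecal :: "real \<Rightarrow> real \<Rightarrow> real \<Rightarrow> plate list \<Rightarrow> plate list \<Rightarrow> real" where
  "Ecal nu1 nu2 nu3 x ys =
     (let q = Qm x ys in exp (nu1 * fst q + nu2 * fst (snd q) + nu3 * snd (snd q)))"

definition Eint ::
  "plate measure \<Rightarrow> real \<Rightarrow> real \<Rightarrow> real \<Rightarrow> nat \<Rightarrow> ((nat \<Rightarrow> plate) \<Rightarrow> real) \<Rightarrow> ennreal" where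
  "Eint lam nu1 nu2 nu3 m g =
     (\<integral>\<^sup>+ y. gibbs_exp lam nu1 nu2 nu3 (\<lambda>x. ennreal (Ecal nu1 nu2 nu3 x (map y [0..<m])))
             * ennreal (g y) \<partial>(PiM {..<m} (\<lambda>_. lam)))"

end

theory Submission
  imports Defs
begin

text \<open>
  Each of S, L, N, and each of their squares, is a linear combination of sums over tuples of pairwise
  distinct plates; for the squares one sorts pairs of tuples by the number of plates they share.
  For such sums the multivariate Mecke formula holds: expanding the Poisson expectation over the number
  of plates, all index tuples contribute equally by symmetry of the density, and the factor
  $n!/(n-m)!$ shifts the series by $m$. It moves the $m$ distinguished plates into the density, where
  the ratio of densities is the exponential of the iterated differences. All integrands are measurable
  because intersections of discs depend upper semicontinuously on the discs.
\<close>

subsection \<open>The multivariate Mecke formula\<close>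

text \<open>All identities are proved in \<open>ennreal\<close>, so sums and integrals are exchanged
  by Tonelli and monotone convergence for nonnegative functions. Configurations are lists and
  \<open>pp_exp\<close> integrates over coordinates in \<open>{..<n}\<close>, hence tuples of
  distinct plates are encoded as lists of distinct positions, and coinciding plates count with
  multiplicity. The price is that invariance under reordering must be proved, and that blocks of
  coordinates must be renumbered so that index sets stay initial segments. Two views of the
  functionals coexist: sums over ordered tuples, which the Mecke formula needs, and sums over
  increasing tuples, in which adding a plate has a visible increment. Symmetry of the kernel links
  them by the factor m!. The constants in the squares count coincidences: two ordered m-tuples can
  share j entries in binomial(m,j)^2 * j! ways. This gives 4, 2 for m = 2 and 9, 18, 6 for m = 3
  (and 1 for j = 0), to be multiplied by (1/2)^2 and (1/6)^2.\<close>

definition dlists :: "nat \<Rightarrow> 'b set \<Rightarrow> 'b list set" where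
  "dlists m A = {is. length is = m \<and> distinct is \<and> set is \<subseteq> A}"

lemma finite_dlists [simp]: "finite A \<Longrightarrow> finite (dlists m A)"
  by (rule finite_subset[OF _ finite_lists_length_eq[of A m]]) (auto simp: dlists_def)

lemma dlists_0 [simp]: "dlists 0 A = {[]}"
  by (auto simp: dlists_def)

text \<open>The head of the list is removed from the pool for the tail. Iterating this gives the
  nested sums over \<open>A\<close>, \<open>A - {i}\<close>, \<open>A - {i} - {j}\<close>, ... in
  which the square identities are stated.\<close>

lemma sum_dlists_Suc:
  assumes "finite A"
  shows "(\<Sum>is\<in>dlists (Suc m) A. f is) = (\<Sum>i\<in>A. \<Sum>is\<in>dlists m (A - {i}). f (i # is))"
proof -
  have "dlists (Suc m) A = (\<lambda>(i, is). i # is) ` Sigma A (\<lambda>i. dlists m (A - {i}))"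
    by (auto simp: dlists_def image_iff length_Suc_conv)
  moreover have "inj_on (\<lambda>(i, is). i # is) (Sigma A (\<lambda>i. dlists m (A - {i})))"
    by (auto simp: inj_on_def)
  ultimately show ?thesis
    using assms by (simp add: sum.reindex sum.Sigma split_def)
qed

text \<open>The falling factorial, in multiplied-out form to stay within the naturals. It supplies
  the factor that turns 1/n! into 1/(n-m)! in the Poisson series.\<close>

lemma card_dlists:
  assumes "finite A" "m \<le> card A"
  shows "card (dlists m A) * fact (card A - m) = fact (card A)"
  using assms
proof (induction m arbitrary: A)
  case (Suc m)
  obtain n where n: "card A = Suc n" using Suc.prems by (cases "card A") auto
  have "card (dlists (Suc m) A) = (\<Sum>i\<in>A. card (dlists m (A - {i})))"
    using sum_dlists_Suc[OF Suc.prems(1), of "\<lambda>_. 1::nat" m] by simp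
  also have "\<dots> * fact (card A - Suc m) = (\<Sum>i\<in>A. card (dlists m (A - {i})) * fact (n - m))"
    by (simp add: n sum_distrib_right)
  also have "\<dots> = (\<Sum>i\<in>A. fact n)"
  proof (rule sum.cong)
    fix i assume "i \<in> A"
    then show "card (dlists m (A - {i})) * fact (n - m) = fact n"
      using Suc.IH[of "A - {i}"] Suc.prems n by simp
  qed simp
  finally show ?case using n by simp
qed simp

lemma dlists_empty: "finite A \<Longrightarrow> card A < m \<Longrightarrow> dlists m A = {}"
  by (auto simp: dlists_def) (metis card_mono distinct_card not_le)

text \<open>This is the integral of \<open>g\<close> against the m-th factorial measure of the
  configuration. Distinctness is imposed on positions and not on values, so no null set of
  coinciding plates has to be removed.\<close>

definition dsum :: "nat \<Rightarrow> ('a list \<Rightarrow> 'b) \<Rightarrow> 'a list \<Rightarrow> 'b::comm_monoid_add" where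
  "dsum m g x = (\<Sum>is\<in>dlists m {..<length x}. g (map ((!) x) is))"

lemma dsum_map_upt: "dsum m g (map y [0..<n]) = (\<Sum>is\<in>dlists m {..<n}. g (map y is))"
  unfolding dsum_def length_map length_upt diff_zero
proof (intro sum.cong refl arg_cong[where f = g])
  fix "is" assume "is \<in> dlists m {..<n}"
  then show "map ((!) (map y [0..<n])) is = map y is"
    by (auto simp: dlists_def)
qed

lemma measurable_map_dlists:
  fixes g :: "'a list \<Rightarrow> 'b" and n :: nat
  assumes g: "(\<lambda>y. g (map y [0..<m])) \<in> PiM {..<m} (\<lambda>_. M) \<rightarrow>\<^sub>M N"
    and "is": "is \<in> dlists m {..<n}"
  shows "(\<lambda>y. g (map y is)) \<in> PiM {..<n} (\<lambda>_. M) \<rightarrow>\<^sub>M N"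
proof -
  have "(\<lambda>y. \<lambda>i\<in>{..<m}. y (is ! i)) \<in> PiM {..<n} (\<lambda>_. M) \<rightarrow>\<^sub>M PiM {..<m} (\<lambda>_. M)"
    using "is" by (intro measurable_restrict measurable_component_singleton)
      (auto simp: dlists_def subset_iff)
  from measurable_compose[OF this g]
  have "(\<lambda>y. g (map (\<lambda>i\<in>{..<m}. y (is ! i)) [0..<m])) \<in> PiM {..<n} (\<lambda>_. M) \<rightarrow>\<^sub>M N" .
  moreover have "map (\<lambda>i\<in>{..<m}. y (is ! i)) [0..<m] = map y is" for y :: "nat \<Rightarrow> 'a"
    using "is" by (intro nth_equalityI) (auto simp: dlists_def)
  ultimately show ?thesis by simp
qed

section \<open>Relabelling and concatenating coordinates of finite product measures\<close>

text \<open>A finite product measure is determined by its values on boxes; a relabelling pulls a box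
  back to the box with relabelled sides, and the product of the side measures does not see their
  order.\<close>

lemma distr_PiM_reindex_finite:
  assumes "sigma_finite_measure M" and I: "finite I" and f: "bij_betw f I J"
  shows "distr (PiM J (\<lambda>_. M)) (PiM I (\<lambda>_. M)) (\<lambda>y. \<lambda>i\<in>I. y (f i)) = PiM I (\<lambda>_. M)"
proof -
  interpret product_sigma_finite "\<lambda>_. M"
    using assms(1) by (simp add: product_sigma_finite_def)
  have J: "finite J" using f I bij_betw_finite by blast
  have fJ: "f i \<in> J" if "i \<in> I" for i using that f by (auto simp: bij_betw_def)
  have meas [measurable]: "(\<lambda>y. \<lambda>i\<in>I. y (f i)) \<in> PiM J (\<lambda>_. M) \<rightarrow>\<^sub>M PiM I (\<lambda>_. M)"
    by (rule measurable_restrict) (auto intro: measurable_component_singleton fJ)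
  show ?thesis
  proof (rule PiM_eqI)
    fix A assume A: "\<And>i. i \<in> I \<Longrightarrow> A i \<in> sets M"
    define g where "g = inv_into I f"
    have g: "g j \<in> I" "f (g j) = j" if "j \<in> J" for j
      using that f by (auto simp: g_def bij_betw_def inv_into_into f_inv_into_f)
    have gf: "g (f i) = i" if "i \<in> I" for i
      using that f by (auto simp: g_def bij_betw_def)
    have "(\<lambda>y. \<lambda>i\<in>I. y (f i)) -` Pi\<^sub>E I A \<inter> space (PiM J (\<lambda>_. M)) = Pi\<^sub>E J (\<lambda>j. A (g j))"
      (is "?L = ?R")
    proof (intro set_eqI iffI)
      fix y assume y: "y \<in> ?L"
      have "y j \<in> A (g j)" if "j \<in> J" for j
        using y g[OF that] by (force simp: PiE_iff)
      with y show "y \<in> ?R" by (auto simp: space_PiM PiE_iff)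
    next
      fix y assume y: "y \<in> ?R"
      have "y j \<in> space M" if "j \<in> J" for j
        using y A[OF g(1)[OF that]] that sets.sets_into_space by (fastforce simp: PiE_iff)
      moreover have "y (f i) \<in> A i" if "i \<in> I" for i
        using y fJ[OF that] gf[OF that] by (force simp: PiE_iff)
      ultimately show "y \<in> ?L"
        using y by (auto simp: space_PiM PiE_iff)
    qed
    then have "emeasure (distr (PiM J (\<lambda>_. M)) (PiM I (\<lambda>_. M)) (\<lambda>y. \<lambda>i\<in>I. y (f i))) (Pi\<^sub>E I A)
        = emeasure (PiM J (\<lambda>_. M)) (Pi\<^sub>E J (\<lambda>j. A (g j)))"
      using A I by (subst emeasure_distr) (auto intro!: sets_PiM_I_finite)
    also have "\<dots> = (\<Prod>j\<in>J. emeasure M (A (g j)))"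
      using J A g by (subst emeasure_PiM) auto
    also have "\<dots> = (\<Prod>i\<in>I. emeasure M (A (g (f i))))"
      by (rule prod.reindex_bij_betw[OF f, symmetric])
    also have "\<dots> = (\<Prod>i\<in>I. emeasure M (A i))"
      by (rule prod.cong) (auto simp: gf)
    finally show "emeasure (distr (PiM J (\<lambda>_. M)) (PiM I (\<lambda>_. M)) (\<lambda>y. \<lambda>i\<in>I. y (f i))) (Pi\<^sub>E I A)
      = (\<Prod>i\<in>I. emeasure M (A i))" .
  qed (simp_all add: I)
qed

lemma nn_integral_PiM_permute:
  fixes F :: "'a list \<Rightarrow> ennreal"
  assumes "sigma_finite_measure M"
    and F [measurable]: "(\<lambda>y. F (map y [0..<n])) \<in> borel_measurable (PiM {..<n} (\<lambda>_. M))"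
    and L: "distinct L" "set L = {..<n}"
  shows "(\<integral>\<^sup>+ y. F (map y L) \<partial>PiM {..<n} (\<lambda>_. M)) = (\<integral>\<^sup>+ y. F (map y [0..<n]) \<partial>PiM {..<n} (\<lambda>_. M))"
proof -
  let ?P = "PiM {..<n} (\<lambda>_. M)" and ?t = "\<lambda>y. \<lambda>i\<in>{..<n}. y (L ! i)"
  have len: "length L = n" using L distinct_card by fastforce
  have bij: "bij_betw ((!) L) {..<n} {..<n}" using L len bij_betw_nth by blast
  have meas: "?t \<in> ?P \<rightarrow>\<^sub>M ?P"
    using bij by (intro measurable_restrict measurable_component_singleton) (auto simp: bij_betw_def)
  have "(\<integral>\<^sup>+ y. F (map y [0..<n]) \<partial>?P) = (\<integral>\<^sup>+ y. F (map y [0..<n]) \<partial>distr ?P ?P ?t)"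
    by (simp add: distr_PiM_reindex_finite[OF assms(1) _ bij])
  also have "\<dots> = (\<integral>\<^sup>+ y. F (map (?t y) [0..<n]) \<partial>?P)"
    by (rule nn_integral_distr[OF meas]) simp
  also have "\<dots> = (\<integral>\<^sup>+ y. F (map y L) \<partial>?P)"
  proof -
    have "map (?t y) [0..<n] = map y L" for y :: "nat \<Rightarrow> 'a"
      by (rule nth_equalityI) (auto simp: len)
    then show ?thesis by simp
  qed
  finally show ?thesis by simp
qed

text \<open>The restriction to \<open>{..<m+k}\<close> makes the glued function extensional, hence a
  point of the product space, so that the append of two samples is the image under the map
  transported by \<open>distr_concat_PiM\<close>.\<close>

lemma map_append_eq_map_upt:
  "map y [0..<m] @ map x [0..<k] = map (\<lambda>i\<in>{..<m+k}. if i < m then y i else x (i - m)) [0..<m+k]"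
  by (rule nth_equalityI) (auto simp: nth_append)

lemma measurable_concat_PiM:
  "(\<lambda>(y, x). \<lambda>i\<in>{..<m+k}. if i < m then y i else x (i - m))
     \<in> PiM {..<m} (\<lambda>_. M) \<Otimes>\<^sub>M PiM {..<k} (\<lambda>_. M) \<rightarrow>\<^sub>M PiM {..<m+k::nat} (\<lambda>_. M)"
  unfolding split_def
proof (rule measurable_restrict)
  fix i assume i: "i \<in> {..<m+k}"
  show "(\<lambda>p. if i < m then fst p i else snd p (i - m))
    \<in> PiM {..<m} (\<lambda>_. M) \<Otimes>\<^sub>M PiM {..<k} (\<lambda>_. M) \<rightarrow>\<^sub>M M"
  proof (cases "i < m")
    case True
    then show ?thesis
      using measurable_compose[OF measurable_fst measurable_component_singleton[of i "{..<m}" "\<lambda>_. M"]]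
      by simp
  next
    case False
    then have "i - m \<in> {..<k}" using i by auto
    from measurable_compose[OF measurable_snd measurable_component_singleton[OF this, of "\<lambda>_. M"]]
    show ?thesis using False by simp
  qed
qed

text \<open>The preimage of a box is a product of two boxes, the second with indices shifted by
  \<open>m\<close>; the measure of the box factorises accordingly. This identifies the m-fold times
  the k-fold product with the (m+k)-fold one.\<close>

lemma distr_concat_PiM:
  assumes "sigma_finite_measure M"
  shows "distr (PiM {..<m} (\<lambda>_. M) \<Otimes>\<^sub>M PiM {..<k} (\<lambda>_. M)) (PiM {..<m+k} (\<lambda>_. M))
     (\<lambda>(y, x). \<lambda>i\<in>{..<m+k}. if i < m then y i else x (i - m)) = PiM {..<m+k::nat} (\<lambda>_. M)"
    (is "distr ?P ?R ?t = _")
proof -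
  interpret product_sigma_finite "\<lambda>_. M"
    using assms(1) by (simp add: product_sigma_finite_def)
  interpret K: sigma_finite_measure "PiM {..<k} (\<lambda>_. M)"
    by (rule sigma_finite) simp
  show ?thesis
  proof (rule PiM_eqI)
    fix A assume A: "\<And>i. i \<in> {..<m+k} \<Longrightarrow> A i \<in> sets M"
    have sub: "A i \<subseteq> space M" if "i < m + k" for i using A[of i] that sets.sets_into_space by auto
    have "?t -` Pi\<^sub>E {..<m+k} A \<inter> space ?P = Pi\<^sub>E {..<m} A \<times> Pi\<^sub>E {..<k} (\<lambda>i. A (m + i))"
      (is "?L = ?T")
    proof (intro set_eqI iffI)
      fix p assume p: "p \<in> ?L"
      obtain y x where yx: "p = (y, x)" by (cases p)
      have h: "(if i < m then y i else x (i - m)) \<in> A i" if "i < m + k" for i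
        using p that by (auto simp: yx PiE_iff)
      have "y i \<in> A i" if "i < m" for i using h[of i] that by simp
      moreover have "x i \<in> A (m + i)" if "i < k" for i using h[of "m + i"] that by simp
      ultimately show "p \<in> ?T" using p by (auto simp: yx space_pair_measure space_PiM PiE_iff)
    next
      fix p assume p: "p \<in> ?T"
      obtain y x where yx: "p = (y, x)" by (cases p)
      have y: "y i \<in> A i" if "i < m" for i using p that by (auto simp: yx PiE_iff)
      have x: "x i \<in> A (m + i)" if "i < k" for i using p that by (auto simp: yx PiE_iff)
      have "y i \<in> space M" if "i < m" for i using y[OF that] sub[of i] that by auto
      moreover have "x i \<in> space M" if "i < k" for i using x[OF that] sub[of "m + i"] that by auto
      moreover have "(if i < m then y i else x (i - m)) \<in> A i" if "i < m + k" for i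
        using y[of i] x[of "i - m"] that by auto
      ultimately show "p \<in> ?L" using p
        by (auto simp: yx space_pair_measure space_PiM PiE_iff)
    qed
    then have "emeasure (distr ?P ?R ?t) (Pi\<^sub>E {..<m+k} A)
        = emeasure ?P (Pi\<^sub>E {..<m} A \<times> Pi\<^sub>E {..<k} (\<lambda>i. A (m + i)))"
      using A by (subst emeasure_distr[OF measurable_concat_PiM]) (auto intro!: sets_PiM_I_finite)
    also have "\<dots> = emeasure (PiM {..<m} (\<lambda>_. M)) (Pi\<^sub>E {..<m} A)
        * emeasure (PiM {..<k} (\<lambda>_. M)) (Pi\<^sub>E {..<k} (\<lambda>i. A (m + i)))"
      using A by (intro K.emeasure_pair_measure_Times sets_PiM_I_finite) auto
    also have "\<dots> = (\<Prod>i<m. emeasure M (A i)) * (\<Prod>i<k. emeasure M (A (m + i)))"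
      using A by (subst (1 2) emeasure_PiM) auto
    also have "\<dots> = (\<Prod>i<m+k. emeasure M (A i))"
      by (induction k) (simp_all flip: mult.assoc)
    finally show "emeasure (distr ?P ?R ?t) (Pi\<^sub>E {..<m+k} A) = (\<Prod>i<m+k. emeasure M (A i))" .
  qed simp_all
qed

lemma measurable_append_PiM:
  assumes "(\<lambda>z. F (map z [0..<m+k])) \<in> borel_measurable (PiM {..<m+k} (\<lambda>_. M))"
  shows "(\<lambda>(y, x). F (map y [0..<m] @ map x [0..<k]))
     \<in> borel_measurable (PiM {..<m} (\<lambda>_. M) \<Otimes>\<^sub>M PiM {..<k} (\<lambda>_. M))"
  using measurable_compose[OF measurable_concat_PiM assms]
  by (simp only: split_def map_append_eq_map_upt)

lemma nn_integral_PiM_append: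
  fixes F :: "'a list \<Rightarrow> ennreal"
  assumes "sigma_finite_measure M"
    and F [measurable]: "(\<lambda>z. F (map z [0..<m+k])) \<in> borel_measurable (PiM {..<m+k} (\<lambda>_. M))"
  shows "(\<integral>\<^sup>+ z. F (map z [0..<m+k]) \<partial>PiM {..<m+k} (\<lambda>_. M))
     = (\<integral>\<^sup>+ y. \<integral>\<^sup>+ x. F (map y [0..<m] @ map x [0..<k]) \<partial>PiM {..<k} (\<lambda>_. M) \<partial>PiM {..<m} (\<lambda>_. M))"
proof -
  interpret product_sigma_finite "\<lambda>_. M"
    using assms(1) by (simp add: product_sigma_finite_def)
  interpret K: sigma_finite_measure "PiM {..<k} (\<lambda>_. M)"
    by (rule sigma_finite) simp
  show ?thesis
    unfolding K.nn_integral_fst[OF measurable_append_PiM[OF F], unfolded split_def fst_conv snd_conv]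
    by (subst distr_concat_PiM[OF assms(1), symmetric], subst nn_integral_distr[OF measurable_concat_PiM])
      (simp_all add: split_def map_append_eq_map_upt del: upt_Suc)
qed

text \<open>By symmetry of h all index lists contribute equally to the n-particle integral.\<close>
lemma nn_integral_sum_dlists:
  fixes g h :: "'a list \<Rightarrow> ennreal"
  assumes "sigma_finite_measure M"
    and h [measurable]: "\<And>n. (\<lambda>y. h (map y [0..<n])) \<in> borel_measurable (PiM {..<n} (\<lambda>_. M))"
    and g [measurable]: "(\<lambda>y. g (map y [0..<m])) \<in> borel_measurable (PiM {..<m} (\<lambda>_. M))"
    and sym: "\<And>xs ys. mset xs = mset ys \<Longrightarrow> h xs = h ys"
  shows "(\<integral>\<^sup>+ y. h (map y [0..<m+k]) * (\<Sum>is\<in>dlists m {..<m+k}. g (map y is)) \<partial>PiM {..<m+k} (\<lambda>_. M))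
     = of_nat (card (dlists m {..<m+k})) *
       (\<integral>\<^sup>+ y. (\<integral>\<^sup>+ x. h (map y [0..<m] @ map x [0..<k]) \<partial>PiM {..<k} (\<lambda>_. M)) * g (map y [0..<m])
          \<partial>PiM {..<m} (\<lambda>_. M))"
proof -
  let ?P = "\<lambda>n. PiM {..<n} (\<lambda>_. M)"
  define F where "F xs = h xs * g (take m xs)" for xs
  note gm = measurable_map_dlists[where g = g, OF g]
  have "[0..<m] \<in> dlists m {..<m+k}" by (auto simp: dlists_def)
  note gm0 = gm[OF this]
  have take: "take m (map y [0..<m+k]) = map y [0..<m]" for y :: "nat \<Rightarrow> 'a"
    by (rule nth_equalityI) auto
  have F [measurable]: "(\<lambda>y. F (map y [0..<m+k])) \<in> borel_measurable (?P (m+k))"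
    unfolding F_def take using gm0 by measurable
  have one: "(\<integral>\<^sup>+ y. h (map y [0..<m+k]) * g (map y is) \<partial>?P (m+k)) = (\<integral>\<^sup>+ y. F (map y [0..<m+k]) \<partial>?P (m+k))"
    if "is \<in> dlists m {..<m+k}" for "is"
  proof -
    \<comment> \<open>\<open>is\<close> is completed to an enumeration of all positions. The value
      of \<open>h\<close> ignores this reordering, and the first \<open>m\<close> entries feed
      \<open>g\<close>, so \<open>F\<close> along \<open>L\<close> is exactly the integrand for
      \<open>is\<close>.\<close>
    define L where "L = is @ filter (\<lambda>i. i \<notin> set is) [0..<m+k]"
    have L: "distinct L" "set L = {..<m+k}" using that by (auto simp: L_def dlists_def)
    have "mset L = mset [0..<m+k]"
      using L by (metis atLeast_upt distinct_upt set_eq_iff_mset_eq_distinct)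
    then have "h (map y [0..<m+k]) = h (map y L)" for y by (intro sym) simp
    moreover have "take m (map y L) = map y is" for y :: "nat \<Rightarrow> 'a"
      using that by (simp add: L_def dlists_def take_map)
    ultimately have "(\<integral>\<^sup>+ y. h (map y [0..<m+k]) * g (map y is) \<partial>?P (m+k))
        = (\<integral>\<^sup>+ y. F (map y L) \<partial>?P (m+k))"
      by (simp add: F_def)
    then show ?thesis using nn_integral_PiM_permute[OF assms(1) F L] by simp
  qed
  interpret product_sigma_finite "\<lambda>_. M"
    using assms(1) by (simp add: product_sigma_finite_def)
  have K: "(\<lambda>x. h (map y [0..<m] @ map x [0..<k])) \<in> borel_measurable (?P k)"
    if "y \<in> space (?P m)" for y
    using measurable_compose[OF measurable_Pair1'[OF that] measurable_append_PiM[where F=h, OF h]] by simp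
  have "(\<integral>\<^sup>+ y. h (map y [0..<m+k]) * (\<Sum>is\<in>dlists m {..<m+k}. g (map y is)) \<partial>?P (m+k))
      = (\<Sum>is\<in>dlists m {..<m+k}. \<integral>\<^sup>+ y. h (map y [0..<m+k]) * g (map y is) \<partial>?P (m+k))"
    unfolding sum_distrib_left by (intro nn_integral_sum borel_measurable_times_ennreal h gm)
  also have "\<dots> = of_nat (card (dlists m {..<m+k})) * (\<integral>\<^sup>+ y. F (map y [0..<m+k]) \<partial>?P (m+k))"
    using one by simp
  also have "(\<integral>\<^sup>+ y. F (map y [0..<m+k]) \<partial>?P (m+k))
      = (\<integral>\<^sup>+ y. \<integral>\<^sup>+ x. h (map y [0..<m] @ map x [0..<k]) * g (map y [0..<m]) \<partial>?P k \<partial>?P m)"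
    by (subst nn_integral_PiM_append[OF assms(1) F]) (simp add: F_def)
  also have "\<dots> = (\<integral>\<^sup>+ y. (\<integral>\<^sup>+ x. h (map y [0..<m] @ map x [0..<k]) \<partial>?P k) * g (map y [0..<m]) \<partial>?P m)"
    by (intro nn_integral_cong nn_integral_multc K)
  finally show ?thesis .
qed

text \<open>The Mecke formula for integrands of product form: \<open>h\<close> depends on the whole
  configuration and will be the density, \<open>g\<close> on the chosen m-tuple. The prefactor of
  \<open>pp_exp\<close> is the same on both sides.\<close>

theorem pp_exp_Mecke:
  fixes g h :: "plate list \<Rightarrow> ennreal"
  assumes "sigma_finite_measure lam"
    and h: "\<And>n. (\<lambda>y. h (map y [0..<n])) \<in> borel_measurable (PiM {..<n} (\<lambda>_. lam))"
    and g: "(\<lambda>y. g (map y [0..<m])) \<in> borel_measurable (PiM {..<m} (\<lambda>_. lam))"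
    and sym: "\<And>xs ys. mset xs = mset ys \<Longrightarrow> h xs = h ys"
  shows "pp_exp lam (\<lambda>x. h x * dsum m g x)
     = (\<integral>\<^sup>+ y. pp_exp lam (\<lambda>x. h (map y [0..<m] @ x)) * g (map y [0..<m]) \<partial>PiM {..<m} (\<lambda>_. lam))"
proof -
  let ?P = "\<lambda>n. PiM {..<n} (\<lambda>_. lam)"
  define T where "T n = ennreal (1 / fact n) *
     (\<integral>\<^sup>+ y. h (map y [0..<n]) * (\<Sum>is\<in>dlists m {..<n}. g (map y is)) \<partial>?P n)" for n
  define R where "R k y = (\<integral>\<^sup>+ x. h (map y [0..<m] @ map x [0..<k]) \<partial>?P k)" for k y
  define c where "c = ennreal (exp (- measure lam (space lam)))"
  interpret product_sigma_finite "\<lambda>_. lam"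
    using assms(1) by (simp add: product_sigma_finite_def)
  have R [measurable]: "R k \<in> borel_measurable (?P m)" for k
  proof -
    interpret K: sigma_finite_measure "?P k" by (rule sigma_finite) simp
    show ?thesis
      unfolding R_def
      using K.borel_measurable_nn_integral_fst[OF measurable_append_PiM[where F=h, OF h, of m k]]
      by simp
  qed
  have T0: "T n = 0" if "n < m" for n
    using that by (simp add: T_def dlists_empty)
  have TS: "T (k + m) = ennreal (1 / fact k) * (\<integral>\<^sup>+ y. R k y * g (map y [0..<m]) \<partial>?P m)" for k
  proof -
    \<comment> \<open>The number of index tuples is (m+k)!/k!, so it cancels the Poisson weight
      1/(m+k)! down to 1/k!, the weight of the k remaining points.\<close>
    have "card (dlists m {..<m+k}) * fact k = (fact (m + k) :: nat)"
      using card_dlists[of "{..<m+k}" m] by simp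
    then have "real (card (dlists m {..<m+k})) * fact k = fact (m + k)"
      by (metis of_nat_fact of_nat_mult)
    then have *: "1 / fact (m + k) * real (card (dlists m {..<m+k})) = 1 / fact k"
      by (simp add: field_simps)
    have "ennreal (1 / fact (m + k)) * of_nat (card (dlists m {..<m+k})) = ennreal (1 / fact k)"
      unfolding ennreal_of_nat_eq_real_of_nat by (subst ennreal_mult[symmetric]) (simp_all only: *, simp_all)
    then show ?thesis
      unfolding T_def R_def add.commute[of k m]
      by (subst nn_integral_sum_dlists[OF assms(1) h g sym]) (simp_all flip: mult.assoc)
  qed
  have "pp_exp lam (\<lambda>x. h x * dsum m g x) = c * (\<Sum>n. T n)"
    by (simp add: pp_exp_def T_def c_def dsum_map_upt)
  \<comment> \<open>Fewer than \<open>m\<close> points carry no tuple of \<open>m\<close> distinct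
    positions, so the first \<open>m\<close> terms vanish and the shift loses nothing.\<close>
  also have "(\<Sum>n. T n) = (\<Sum>k. T (k + m))"
    using suminf_offset[of T m] T0 by simp
  also have "\<dots> = (\<Sum>k. \<integral>\<^sup>+ y. ennreal (1 / fact k) * R k y * g (map y [0..<m]) \<partial>?P m)"
    unfolding TS mult.assoc using g by (intro arg_cong[where f=suminf] ext nn_integral_cmult[symmetric]) measurable
  also have "\<dots> = (\<integral>\<^sup>+ y. (\<Sum>k. ennreal (1 / fact k) * R k y * g (map y [0..<m])) \<partial>?P m)"
    using g by (intro nn_integral_suminf[symmetric]) measurable
  also have "c * \<dots> = (\<integral>\<^sup>+ y. c * (\<Sum>k. ennreal (1 / fact k) * R k y * g (map y [0..<m])) \<partial>?P m)"
    using g by (intro nn_integral_cmult[symmetric]) measurable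
  also have "\<dots> = (\<integral>\<^sup>+ y. pp_exp lam (\<lambda>x. h (map y [0..<m] @ x)) * g (map y [0..<m]) \<partial>?P m)"
    unfolding pp_exp_def c_def R_def ennreal_suminf_multc by (simp only: mult.assoc)
  finally show ?thesis .
qed

subsection \<open>Difference operators of the Hamiltonian\<close>

text \<open>A rearrangement of the list is a permutation of positions, which maps the set of
  distinct index lists onto itself and thus only reindexes the sum. This yields the symmetry of the
  density required by the Mecke formula.\<close>

lemma dsum_mset_cong:
  assumes "mset xs = mset ys"
  shows "dsum m g xs = dsum m g ys"
proof -
  obtain p where p: "p permutes {..<length ys}" "permute_list p ys = xs"
    using mset_eq_permutation[OF assms] .
  have len: "length xs = length ys" using p by auto
  have inj: "inj p" using p(1) permutes_inj by blast
  have mp: "map p ` dlists m {..<length ys} = dlists m {..<length ys}"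
  proof (intro equalityI subsetI)
    fix is' assume "is' \<in> map p ` dlists m {..<length ys}"
    then show "is' \<in> dlists m {..<length ys}"
      using permutes_in_image[OF p(1)] inj
      by (auto simp: dlists_def distinct_map inj_on_def subset_iff)
  next
    fix is' assume "is' \<in> dlists m {..<length ys}"
    moreover from p(1) have "is' = map p (map (inv p) is')"
      by (simp add: o_def permutes_inverses)
    ultimately show "is' \<in> map p ` dlists m {..<length ys}"
      using permutes_in_image[OF permutes_inv[OF p(1)]] permutes_inj[OF permutes_inv[OF p(1)]]
      by (intro image_eqI[where x = "map (inv p) is'"])
        (auto simp: dlists_def distinct_map inj_on_def subset_iff)
  qed
  have "dsum m g ys = (\<Sum>is\<in>map p ` dlists m {..<length ys}. g (map ((!) ys) is))"
    by (simp add: dsum_def mp)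
  also have "\<dots> = (\<Sum>is\<in>dlists m {..<length ys}. g (map ((!) ys) (map p is)))"
    using inj by (subst sum.reindex) (auto simp: inj_on_def)
  also have "\<dots> = (\<Sum>is\<in>dlists m {..<length ys}. g (map ((!) xs) is))"
  proof (intro sum.cong refl arg_cong[where f = g])
    fix is' assume "is' \<in> dlists m {..<length ys}"
    then show "map ((!) ys) (map p is') = map ((!) xs) is'"
      using p permute_list_nth[OF p(1)] by (auto simp: dlists_def)
  qed
  finally show ?thesis by (simp add: dsum_def len)
qed

lemma S_cfg_eq_dsum: "S_cfg x = dsum 1 (\<lambda>ys. area (ys ! 0)) x"
  by (simp add: S_cfg_def dsum_def sum_dlists_Suc)

lemma L_cfg_eq_dsum: "L_cfg x = 1/2 * dsum 2 (\<lambda>ys. ilen (ys ! 0) (ys ! 1)) x"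
proof -
  have "dpairs n = Sigma {..<n} (\<lambda>i. {..<n} - {i})" for n
    by (auto simp: dpairs_def)
  then show ?thesis
    by (simp add: L_cfg_def dsum_def sum_dlists_Suc numeral_eq_Suc sum.Sigma)
qed

lemma N_cfg_eq_dsum: "N_cfg x = 1/6 * dsum 3 (\<lambda>ys. meet3 (ys ! 0) (ys ! 1) (ys ! 2)) x"
proof -
  have "dtriples n = Sigma {..<n} (\<lambda>i. Sigma ({..<n} - {i}) (\<lambda>j. {..<n} - {i} - {j}))" for n
    by (auto simp: dtriples_def)
  then show ?thesis
    by (simp add: N_cfg_def dsum_def sum_dlists_Suc numeral_eq_Suc sum.Sigma split_def)
qed

lemma hamil_mset_cong: "mset xs = mset ys \<Longrightarrow> hamil nu1 nu2 nu3 xs = hamil nu1 nu2 nu3 ys"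
  by (simp only: hamil_def S_cfg_eq_dsum L_cfg_eq_dsum N_cfg_eq_dsum dsum_mset_cong[of xs ys])

section \<open>Ordered versus increasing tuples, and increments when plates are added\<close>

lemma ilen_commute: "ilen s t = ilen t s"
  by (simp add: ilen_def Int_commute)

lemma meet3_commute: "meet3 s t u = meet3 t s u" "meet3 s t u = meet3 s u t"
  by (simp_all add: meet3_def Int_ac)

text \<open>Together with \<open>tsum\<close>, sums over increasing pairs and triples of positions,
  written by recursion on the list so that prepending a plate exposes its increment.\<close>

fun psum :: "('a \<Rightarrow> 'a \<Rightarrow> 'b::comm_monoid_add) \<Rightarrow> 'a list \<Rightarrow> 'b" where
  "psum f [] = 0"
| "psum f (y # x) = (\<Sum>s\<leftarrow>x. f y s) + psum f x"

fun tsum :: "('a \<Rightarrow> 'a \<Rightarrow> 'a \<Rightarrow> 'b::comm_monoid_add) \<Rightarrow> 'a list \<Rightarrow> 'b" where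
  "tsum f [] = 0"
| "tsum f (y # x) = psum (f y) x + tsum f x"

lemma sum_list_eq_sum_nth: "(\<Sum>s\<leftarrow>x. f s) = (\<Sum>i<length x. f (x ! i))"
  by (simp add: sum.list_conv_set_nth atLeast0LessThan)

text \<open>Pairs are split according to whether the smaller position is 0; those with both
  positions positive are the old pairs shifted by \<open>Suc\<close>. The triple version below
  splits in the same way.\<close>

lemma sum_pairs_eq_psum:
  "(\<Sum>(i, j)\<in>{(i, j). i < j \<and> j < length x}. f (x ! i) (x ! j)) = psum f x"
proof (induction x)
  case (Cons y x)
  have fin: "finite {(i, j). i < j \<and> j < length x}"
    by (rule finite_subset[of _ "{..<length x} \<times> {..<length x}"]) auto
  have "{(i, j). i < j \<and> j < length (y # x)}
      = (\<lambda>j. (0, Suc j)) ` {..<length x} \<union> map_prod Suc Suc ` {(i, j). i < j \<and> j < length x}" (is "?L = ?R")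
  proof (intro set_eqI iffI)
    fix p assume "p \<in> ?L"
    then obtain i j where "p = (i, Suc j)" "i \<le> j" "j < length x"
      by (cases p; cases "snd p") auto
    then show "p \<in> ?R" by (cases i) (auto simp: image_iff)
  qed auto
  then show ?case
    using Cons.IH fin
    by (simp, subst sum.union_disjoint)
      (auto simp: sum.reindex inj_on_def split_def sum_list_eq_sum_nth)
qed simp

lemma sum_triples_eq_tsum:
  "(\<Sum>(i, j, k)\<in>{(i, j, k). i < j \<and> j < k \<and> k < length x}. f (x ! i) (x ! j) (x ! k)) = tsum f x"
proof (induction x)
  case (Cons y x)
  have fin: "finite {(i, j). i < j \<and> j < length x}"
    by (rule finite_subset[of _ "{..<length x} \<times> {..<length x}"]) auto
  have fin': "finite {(i, j, k). i < j \<and> j < k \<and> k < length x}"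
    by (rule finite_subset[of _ "{..<length x} \<times> {..<length x} \<times> {..<length x}"]) auto
  have "{(i, j, k). i < j \<and> j < k \<and> k < length (y # x)}
      = (\<lambda>(j, k). (0, Suc j, Suc k)) ` {(i, j). i < j \<and> j < length x}
       \<union> map_prod Suc (map_prod Suc Suc) ` {(i, j, k). i < j \<and> j < k \<and> k < length x}" (is "?L = ?R1 \<union> ?R2")
  proof (intro set_eqI iffI)
    fix p assume "p \<in> ?L"
    then obtain i j k where "p = (i, Suc j, Suc k)" "i \<le> j" "j < k" "k < length x"
      by (cases p; cases "fst (snd p)"; cases "snd (snd p)") auto
    then show "p \<in> ?R1 \<union> ?R2" by (cases i) (auto simp: image_iff)
  qed auto
  moreover have "?R1 \<inter> ?R2 = {}" by auto
  moreover have "inj_on (\<lambda>(j, k). (0::nat, Suc j, Suc k)) {(i, j). i < j \<and> j < length x}"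
    "inj_on (map_prod Suc (map_prod Suc Suc)) {(i, j, k). i < j \<and> j < k \<and> k < length x}"
    by (auto simp: inj_on_def)
  ultimately show ?case
    using Cons.IH sum_pairs_eq_psum[of "f y" x] fin fin'
    by (simp only: sum.union_disjoint finite_imageI sum.reindex) (simp add: sum.reindex split_def)
qed simp

lemma sum_diff1_if: "finite A \<Longrightarrow> (\<Sum>j\<in>A - {i}. f j) = (\<Sum>j\<in>A. if j = i then 0 else f j)"
  by (rule sum.mono_neutral_cong_left) auto

text \<open>By symmetry every increasing pair is met in 2 orders. The diagonal is filled with zeros
  so that the induction runs over full squares of positions.\<close>

lemma dsum_2_eq_psum:
  fixes f :: "'a \<Rightarrow> 'a \<Rightarrow> real"
  assumes "\<And>s t. f s t = f t s"
  shows "dsum 2 (\<lambda>ys. f (ys ! 0) (ys ! 1)) x = 2 * psum f x"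
proof -
  have "dsum 2 (\<lambda>ys. f (ys ! 0) (ys ! 1)) x = (\<Sum>i<length x. \<Sum>j<length x. if j = i then 0 else f (x ! i) (x ! j))"
    by (simp add: dsum_def sum_dlists_Suc numeral_eq_Suc sum_diff1_if)
  also have "\<dots> = 2 * psum f x"
  proof (induction x)
    case (Cons y x)
    show ?case
      using Cons.IH assms[of _ y]
      by (simp add: sum.lessThan_Suc_shift sum.distrib sum_list_eq_sum_nth del: sum.lessThan_Suc cong: if_cong)
  qed simp
  finally show ?thesis .
qed

lemma dsum_3_eq_tsum:
  fixes f :: "'a \<Rightarrow> 'a \<Rightarrow> 'a \<Rightarrow> real"
  assumes "\<And>s t u. f s t u = f t s u" "\<And>s t u. f s t u = f s u t"
  shows "dsum 3 (\<lambda>ys. f (ys ! 0) (ys ! 1) (ys ! 2)) x = 6 * tsum f x"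
proof -
  \<comment> \<open>Extension by zero to tuples with a repeated position: sums over distinct triples
    become sums over a full cube, which splits cleanly when a first plate is added.\<close>
  define w where "w x i j k = (if i = j \<or> i = k \<or> j = k then 0 else f (x ! i) (x ! j) (x ! k))" for x i j k
  have ws: "w x i j k = w x j i k" "w x i j k = w x i k j" "w x i i k = 0" for x i j k
    using assms by (auto simp: w_def)
  have w_Suc: "w (y # x) (Suc i) (Suc j) (Suc k) = w x i j k" for x y i j k
    by (simp add: w_def)
  \<comment> \<open>Triples through the new plate at position 0: it may occupy any of three slots,
    and each slot contributes \<open>2 * psum (f y) x\<close>, which gives the factor 6.\<close>
  have w0: "(\<Sum>j<length x. \<Sum>k<length x. w (y # x) 0 (Suc j) (Suc k)) = 2 * psum (f y) x" for x y
    using dsum_2_eq_psum[of "f y" x] assms(2)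
    by (simp add: dsum_def sum_dlists_Suc numeral_eq_Suc sum_diff1_if w_def eq_commute cong: if_cong)
  have "dsum 3 (\<lambda>ys. f (ys ! 0) (ys ! 1) (ys ! 2)) x = (\<Sum>i<length x. \<Sum>j<length x. \<Sum>k<length x. w x i j k)"
    by (auto simp add: dsum_def sum_dlists_Suc numeral_eq_Suc sum_diff1_if w_def intro!: sum.cong)
  also have "\<dots> = 6 * tsum f x"
  proof (induction x)
    case (Cons y x)
    have z: "w (y # x) 0 0 k = 0" "w (y # x) 0 k 0 = 0" "w (y # x) k 0 0 = 0" for k
      by (simp_all add: w_def)
    have s: "w (y # x) (Suc j) 0 (Suc k) = w (y # x) 0 (Suc j) (Suc k)"
      "w (y # x) (Suc j) (Suc k) 0 = w (y # x) 0 (Suc j) (Suc k)" for j k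
      using ws by metis+
    show ?case
      using Cons.IH w0[of y x]
      by (simp add: sum.lessThan_Suc_shift sum.distrib w_Suc z s del: sum.lessThan_Suc)
  qed simp
  finally show ?thesis .
qed

lemma S_cfg_eq_sum_list: "S_cfg x = (\<Sum>s\<leftarrow>x. area s)"
  by (simp add: S_cfg_def sum_list_eq_sum_nth)

lemma L_cfg_eq_psum: "L_cfg x = psum ilen x"
  using dsum_2_eq_psum[of ilen x] ilen_commute by (simp add: L_cfg_eq_dsum)

lemma N_cfg_eq_tsum: "N_cfg x = tsum meet3 x"
  using dsum_3_eq_tsum[of meet3 x] meet3_commute by (simp add: N_cfg_eq_dsum)

text \<open>\<open>D2\<close> is the increment of \<open>D1\<close> under adding a plate; in
  \<open>D2_append\<close>, \<open>D3\<close> is likewise the increment of \<open>D2\<close>. Since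
  \<open>D3\<close> no longer depends on the configuration, the expansion stops at third
  order.\<close>

lemma D1_Cons: "D1 (z # x) y = D1 x y + D2 x y z"
proof -
  have "meet3 z s y = meet3 s y z" for s using meet3_commute by metis
  then show ?thesis
    unfolding D1_def sum_pairs_eq_psum[of "\<lambda>s t. meet3 s t y"]
    by (simp add: D2_def ilen_commute)
qed

lemma D2_append: "D2 (ys @ x) y z = D2 x y z + (\<Sum>u\<leftarrow>ys. D3 y z u)"
proof (induction ys)
  case (Cons u ys)
  have "meet3 u y z = meet3 y z u" using meet3_commute by metis
  with Cons show ?case by (auto simp: D2_def D3_def prod_eq_iff)
qed (simp add: zero_prod_def)

lemma D1_append: "D1 (ys @ x) y = D1 x y + (\<Sum>z\<leftarrow>ys. D2 x y z) + psum (D3 y) ys"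
  by (induction ys) (simp_all add: D1_Cons D2_append ac_simps)

lemma Qm_eq_lists: "Qm x ys = (\<Sum>y\<leftarrow>ys. D1 x y) + psum (D2 x) ys + tsum D3 ys"
  by (simp add: Qm_def sum_list_eq_sum_nth sum_pairs_eq_psum sum_triples_eq_tsum)

lemma cfg_Cons: "(S_cfg (y # x), L_cfg (y # x), N_cfg (y # x)) = (S_cfg x, L_cfg x, N_cfg x) + D1 x y"
proof -
  have "psum (meet3 y) x = psum (\<lambda>s t. meet3 s t y) x"
    by (rule arg_cong[where f = "\<lambda>f. psum f x"]) (metis meet3_commute)
  moreover have "ilen y = (\<lambda>s. ilen s y)"
    by (rule ext) (rule ilen_commute)
  ultimately show ?thesis
    unfolding D1_def sum_pairs_eq_psum[of "\<lambda>s t. meet3 s t y"]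
    by (simp add: S_cfg_eq_sum_list L_cfg_eq_psum N_cfg_eq_tsum)
qed

text \<open>Plates are added one at a time. Each step adds \<open>D1\<close> of the configuration
  reached so far, and expanding that value over the plates already added produces the
  \<open>D2\<close> and \<open>D3\<close> terms that extend \<open>Qm\<close>.\<close>

lemma cfg_append:
  "(S_cfg (ys @ x), L_cfg (ys @ x), N_cfg (ys @ x)) = (S_cfg x, L_cfg x, N_cfg x) + Qm x ys"
proof (induction ys)
  case (Cons y ys)
  have "(S_cfg ((y # ys) @ x), L_cfg ((y # ys) @ x), N_cfg ((y # ys) @ x))
      = (S_cfg x, L_cfg x, N_cfg x) + (Qm x ys + D1 (ys @ x) y)"
    using cfg_Cons[of y "ys @ x"] Cons.IH by (simp add: add.assoc)
  also have "Qm x ys + D1 (ys @ x) y = Qm x (y # ys)"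
    by (simp add: Qm_eq_lists D1_append ac_simps)
  finally show ?case .
qed (simp add: Qm_eq_lists zero_prod_def)

text \<open>Exponentiated form of the increment formula: \<open>Ecal\<close> is the ratio of
  densities after and before adding \<open>ys\<close>, that is, the conditional intensity of order
  \<open>length ys\<close>.\<close>

lemma exp_hamil_append:
  "exp (hamil nu1 nu2 nu3 (ys @ x)) = exp (hamil nu1 nu2 nu3 x) * Ecal nu1 nu2 nu3 x ys"
  using cfg_append[of ys x]
  by (simp add: hamil_def Ecal_def Let_def prod_eq_iff algebra_simps flip: exp_add)

subsection \<open>Squares of sums over distinct indices\<close>

text \<open>Renaming two distinct summation indices; used to move a shared index into the first
  slot.\<close>

lemma sum_offdiag_swap:
  fixes H :: "'a \<Rightarrow> 'a \<Rightarrow> 'b::comm_monoid_add"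
  assumes "finite A"
  shows "(\<Sum>i\<in>A. \<Sum>j\<in>A - {i}. H i j) = (\<Sum>i\<in>A. \<Sum>j\<in>A - {i}. H j i)"
proof -
  have "(\<Sum>i\<in>A. \<Sum>j\<in>A - {i}. H i j) = (\<Sum>i\<in>A. \<Sum>j\<in>A. if j = i then 0 else H i j)"
    using assms by (simp add: sum_diff1_if)
  also have "\<dots> = (\<Sum>j\<in>A. \<Sum>i\<in>A. if j = i then 0 else H i j)"
    by (rule sum.swap)
  also have "\<dots> = (\<Sum>i\<in>A. \<Sum>j\<in>A - {i}. H j i)"
    using assms by (auto simp add: sum_diff1_if intro!: sum.cong)
  finally show ?thesis .
qed

lemma sum2_insert:
  fixes w :: "'a \<Rightarrow> 'a \<Rightarrow> real"
  assumes "finite A" "a \<notin> A" "\<And>i j. w i j = w j i" "\<And>i. w i i = 0"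
  shows "(\<Sum>i\<in>insert a A. \<Sum>j\<in>insert a A. w i j) = (\<Sum>i\<in>A. \<Sum>j\<in>A. w i j) + 2 * (\<Sum>j\<in>A. w a j)"
  using assms(1,2,4) assms(3)[of _ a] by (simp add: sum.distrib)

text \<open>As \<open>w\<close> vanishes on repeated indices, a triple contains the new element at
  most once, in one of three slots that symmetry makes equal; for pairs the corresponding factor is
  2.\<close>

lemma sum3_insert:
  fixes w :: "'a \<Rightarrow> 'a \<Rightarrow> 'a \<Rightarrow> real"
  assumes "finite A" "a \<notin> A" "\<And>i j k. w i j k = w j i k" "\<And>i j k. w i j k = w i k j" "\<And>i k. w i i k = 0"
  shows "(\<Sum>i\<in>insert a A. \<Sum>j\<in>insert a A. \<Sum>k\<in>insert a A. w i j k)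
    = (\<Sum>i\<in>A. \<Sum>j\<in>A. \<Sum>k\<in>A. w i j k) + 3 * (\<Sum>j\<in>A. \<Sum>k\<in>A. w a j k)"
proof -
  have z: "w i k i = 0" "w k i i = 0" for i k using assms(3-5) by metis+
  have s: "w j a k = w a j k" "w j k a = w a j k" for j k using assms(3-5) by metis+
  have "(\<Sum>i\<in>insert a A. \<Sum>j\<in>insert a A. \<Sum>k\<in>insert a A. w i j k)
     = (\<Sum>j\<in>A. \<Sum>k\<in>A. w a j k) + (\<Sum>i\<in>A. (\<Sum>k\<in>A. w i a k) + (\<Sum>j\<in>A. w i j a + (\<Sum>k\<in>A. w i j k)))"
    using assms(1,2,5) z by simp
  then show ?thesis by (simp add: s sum.distrib flip: sum_distrib_left)
qed

text \<open>With the first pair fixed, the second is sorted by its overlap with it. One common index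
  arises in 2 * 2 ways (which member of the first pair, which slot of the second), two common
  indices in 2 orders.\<close>

lemma square_sum2:
  fixes w :: "'a \<Rightarrow> 'a \<Rightarrow> real"
  assumes A: "finite A" and sym: "\<And>i j. w i j = w j i" and diag: "\<And>i. w i i = 0"
  shows "(\<Sum>i\<in>A. \<Sum>j\<in>A - {i}. w i j)\<^sup>2 =
      (\<Sum>i\<in>A. \<Sum>j\<in>A - {i}. \<Sum>k\<in>A - {i} - {j}. \<Sum>l\<in>A - {i} - {j} - {k}. w i j * w k l)
    + 4 * (\<Sum>i\<in>A. \<Sum>j\<in>A - {i}. \<Sum>k\<in>A - {i} - {j}. w i j * w k i)
    + 2 * (\<Sum>i\<in>A. \<Sum>j\<in>A - {i}. (w i j)\<^sup>2)"
proof -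
  have off: "(\<Sum>j\<in>U - {i}. w i j) = (\<Sum>j\<in>U. w i j)" if "finite U" for U i
    using that diag by (intro sum.mono_neutral_left) auto
  define T where "T = (\<Sum>i\<in>A. \<Sum>j\<in>A. w i j)"
  define U where "U i j = A - {i} - {j}" for i j
  have finU: "finite (U i j)" for i j using A by (simp add: U_def)
  \<comment> \<open>Vanishing on the diagonal lets the second factor be the full double sum
    \<open>T\<close>; removing \<open>i\<close> and \<open>j\<close> from its range separates the
    three overlaps.\<close>
  have T: "w i j * T = w i j * (\<Sum>k\<in>U i j. \<Sum>l\<in>U i j. w k l)
      + 2 * (w i j * (\<Sum>k\<in>U i j. w k i)) + 2 * (w i j * (\<Sum>k\<in>U i j. w k j)) + 2 * (w i j)\<^sup>2"
    if "i \<in> A" "j \<in> A - {i}" for i j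
  proof -
    have *: "A = insert i (insert j (U i j))" "i \<notin> insert j (U i j)" "j \<notin> U i j"
      using that by (auto simp: U_def)
    have "T = (\<Sum>i'\<in>insert i (insert j (U i j)). \<Sum>j'\<in>insert i (insert j (U i j)). w i' j')"
      using *(1) by (simp add: T_def)
    also have "\<dots> = (\<Sum>k\<in>U i j. \<Sum>l\<in>U i j. w k l) + 2 * (\<Sum>k\<in>U i j. w j k)
        + 2 * (w i j + (\<Sum>k\<in>U i j. w i k))"
      using *(2,3) finU sum2_insert[of "insert j (U i j)" i w] sum2_insert[of "U i j" j w] sym diag
      by simp
    also have "(\<Sum>k\<in>U i j. w j k) = (\<Sum>k\<in>U i j. w k j)"
      by (rule sum.cong[OF refl sym])
    also have "(\<Sum>k\<in>U i j. w i k) = (\<Sum>k\<in>U i j. w k i)"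
      by (rule sum.cong[OF refl sym])
    finally have "T = (\<Sum>k\<in>U i j. \<Sum>l\<in>U i j. w k l) + 2 * (\<Sum>k\<in>U i j. w k j)
        + 2 * (w i j + (\<Sum>k\<in>U i j. w k i))" .
    then show ?thesis by (simp add: algebra_simps power2_eq_square)
  qed
  have "(\<Sum>i\<in>A. \<Sum>j\<in>A - {i}. w i j)\<^sup>2 = (\<Sum>i\<in>A. \<Sum>j\<in>A - {i}. w i j * T)"
    by (simp add: power2_eq_square T_def off A flip: sum_distrib_right)
  also have "\<dots> = (\<Sum>i\<in>A. \<Sum>j\<in>A - {i}. w i j * (\<Sum>k\<in>U i j. \<Sum>l\<in>U i j. w k l))
      + 2 * (\<Sum>i\<in>A. \<Sum>j\<in>A - {i}. w i j * (\<Sum>k\<in>U i j. w k i))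
      + 2 * (\<Sum>i\<in>A. \<Sum>j\<in>A - {i}. w i j * (\<Sum>k\<in>U i j. w k j))
      + 2 * (\<Sum>i\<in>A. \<Sum>j\<in>A - {i}. (w i j)\<^sup>2)"
    by (simp add: T sum.distrib sum_distrib_left)
  \<comment> \<open>Exchanging the names of \<open>i\<close> and \<open>j\<close> turns overlap in
    \<open>j\<close> into overlap in \<open>i\<close>, so the coefficients 2 and 2 merge into
    4.\<close>
  also have "(\<Sum>i\<in>A. \<Sum>j\<in>A - {i}. w i j * (\<Sum>k\<in>U i j. w k j))
      = (\<Sum>i\<in>A. \<Sum>j\<in>A - {i}. w i j * (\<Sum>k\<in>U i j. w k i))"
  proof -
    have "w j i * (\<Sum>k\<in>U j i. w k i) = w i j * (\<Sum>k\<in>U i j. w k i)" for i j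
      by (simp add: sym[of i j] U_def Diff_insert2[symmetric] insert_commute flip: Diff_insert)
    then show ?thesis
      using sum_offdiag_swap[OF A, of "\<lambda>i j. w i j * (\<Sum>k\<in>U i j. w k j)"] by simp
  qed
  also have "(\<Sum>i\<in>A. \<Sum>j\<in>A - {i}. w i j * (\<Sum>k\<in>U i j. \<Sum>l\<in>U i j. w k l))
      = (\<Sum>i\<in>A. \<Sum>j\<in>A - {i}. \<Sum>k\<in>A - {i} - {j}. \<Sum>l\<in>A - {i} - {j} - {k}. w i j * w k l)"
    using finU by (simp add: U_def off flip: sum_distrib_left)
  finally show ?thesis
    by (simp add: U_def sum_distrib_left)
qed

text \<open>The same sorting for triples: j common indices are chosen in both triples and matched,
  giving 9, 18 and 6 for j = 1, 2, 3.\<close>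

lemma square_sum3:
  fixes w :: "'a \<Rightarrow> 'a \<Rightarrow> 'a \<Rightarrow> real"
  assumes A: "finite A" and sym: "\<And>i j k. w i j k = w j i k" "\<And>i j k. w i j k = w i k j"
    and diag: "\<And>i k. w i i k = 0"
  shows "(\<Sum>i\<in>A. \<Sum>j\<in>A - {i}. \<Sum>k\<in>A - {i} - {j}. w i j k)\<^sup>2 =
      (\<Sum>i\<in>A. \<Sum>j\<in>A - {i}. \<Sum>k\<in>A - {i} - {j}. \<Sum>a\<in>A - {i} - {j} - {k}. \<Sum>b\<in>A - {i} - {j} - {k} - {a}.
         \<Sum>c\<in>A - {i} - {j} - {k} - {a} - {b}. w i j k * w a b c)
    + 9 * (\<Sum>i\<in>A. \<Sum>j\<in>A - {i}. \<Sum>k\<in>A - {i} - {j}. \<Sum>a\<in>A - {i} - {j} - {k}. \<Sum>b\<in>A - {i} - {j} - {k} - {a}.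
         w i j k * w a b i)
    + 18 * (\<Sum>i\<in>A. \<Sum>j\<in>A - {i}. \<Sum>k\<in>A - {i} - {j}. \<Sum>a\<in>A - {i} - {j} - {k}. w i j k * w a j i)
    + 6 * (\<Sum>i\<in>A. \<Sum>j\<in>A - {i}. \<Sum>k\<in>A - {i} - {j}. (w i j k)\<^sup>2)"
proof -
  have diag': "w i k i = 0" "w k i i = 0" for i k using sym diag by metis+
  have rot: "w a b i = w i a b" "w a j i = w i j a" for a b i j using sym by metis+
  have off1: "(\<Sum>k\<in>U - {i} - {j}. w i j k) = (\<Sum>k\<in>U. w i j k)" if "finite U" for U i j
    using that diag diag' by (intro sum.mono_neutral_left) auto
  have off1': "(\<Sum>k\<in>U - {j}. w i j k) = (\<Sum>k\<in>U. w i j k)" if "finite U" for U i j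
    using that diag diag' by (intro sum.mono_neutral_left) auto
  have off2: "(\<Sum>j\<in>U - {i}. \<Sum>k\<in>U. w i j k) = (\<Sum>j\<in>U. \<Sum>k\<in>U. w i j k)" if "finite U" for U i
    using that diag diag' by (intro sum.mono_neutral_left) auto
  define T where "T = (\<Sum>i\<in>A. \<Sum>j\<in>A. \<Sum>k\<in>A. w i j k)"
  define U where "U i j k = A - {i} - {j} - {k}" for i j k
  \<comment> \<open>\<open>T3\<close>, \<open>T2\<close>, \<open>T1\<close> sum \<open>w\<close>
    over \<open>V\<close> in its free slots, with none, one or two slots already fixed.\<close>
  define T3 where "T3 V = (\<Sum>a\<in>V. \<Sum>b\<in>V. \<Sum>c\<in>V. w a b c)" for V
  define T2 where "T2 i V = (\<Sum>a\<in>V. \<Sum>b\<in>V. w i a b)" for i V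
  define T1 where "T1 i j V = (\<Sum>a\<in>V. w i j a)" for i j V
  have T1_commute: "T1 i j V = T1 j i V" for i j V by (simp add: T1_def sym(1)[of i])
  have finU: "finite (U i j k)" for i j k using A by (simp add: U_def)
  have U_commute: "U i j k = U j i k" "U i j k = U i k j" for i j k by (auto simp: U_def)
  have T3i: "T3 (insert i V) = T3 V + 3 * T2 i V" if "finite V" "i \<notin> V" for i V
    unfolding T3_def T2_def by (rule sum3_insert) (use that sym diag in auto)
  have T2i: "T2 i (insert j V) = T2 i V + 2 * T1 i j V" if "finite V" "j \<notin> V" for i j V
    unfolding T2_def T1_def by (rule sum2_insert) (use that sym diag' in auto)
  have T1i: "T1 i j (insert k V) = T1 i j V + w i j k" if "finite V" "k \<notin> V" for i j k V
    unfolding T1_def using that by simp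
  define O3 where "O3 H = (\<Sum>i\<in>A. \<Sum>j\<in>A - {i}. \<Sum>k\<in>A - {i} - {j}. H i j k)" for H :: "'a \<Rightarrow> 'a \<Rightarrow> 'a \<Rightarrow> real"
  have swap12: "O3 H = O3 (\<lambda>i j k. H j i k)" for H
  proof -
    have "A - {j} - {i} = A - {i} - {j}" for i j by auto
    then show ?thesis
      unfolding O3_def
      using sum_offdiag_swap[OF A, of "\<lambda>i j. \<Sum>k\<in>A - {i} - {j}. H i j k"] by simp
  qed
  have swap23: "O3 H = O3 (\<lambda>i j k. H i k j)" for H
    unfolding O3_def using A by (intro sum.cong refl sum_offdiag_swap) auto
  have T: "w i j k * T = w i j k * T3 (U i j k)
      + 3 * (w i j k * T2 i (U i j k)) + 3 * (w i j k * T2 j (U i j k)) + 3 * (w i j k * T2 k (U i j k))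
      + 6 * (w i j k * T1 i j (U i j k)) + 6 * (w i j k * T1 i k (U i j k)) + 6 * (w i j k * T1 j k (U i j k))
      + 6 * (w i j k)\<^sup>2"
    if "i \<in> A" "j \<in> A - {i}" "k \<in> A - {i} - {j}" for i j k
  proof -
    have *: "A = insert i (insert j (insert k (U i j k)))"
      "i \<notin> insert j (insert k (U i j k))" "j \<notin> insert k (U i j k)" "k \<notin> U i j k"
      using that by (auto simp: U_def)
    have "T = T3 (insert i (insert j (insert k (U i j k))))"
      using *(1) by (simp add: T_def T3_def)
    \<comment> \<open>The three elements are inserted in the order \<open>k\<close>,
      \<open>j\<close>, \<open>i\<close>. An insertion into \<open>T3\<close> costs a factor 3 and
      one into \<open>T2\<close> a factor 2, so each single overlap has weight 3, each double
      overlap 6 and the full overlap 6.\<close>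
    also have "\<dots> = T3 (U i j k) + 3 * T2 k (U i j k) + 3 * (T2 j (U i j k) + 2 * T1 j k (U i j k))
       + 3 * (T2 i (U i j k) + 2 * T1 i k (U i j k) + 2 * (T1 i j (U i j k) + w i j k))"
      using *(2-4) finU by (simp add: T3i T2i T1i)
    finally show ?thesis by (simp add: algebra_simps power2_eq_square)
  qed
  have "(\<Sum>i\<in>A. \<Sum>j\<in>A - {i}. \<Sum>k\<in>A - {i} - {j}. w i j k)\<^sup>2 = O3 (\<lambda>i j k. w i j k) * T"
    by (simp add: power2_eq_square T_def O3_def off1 off2 A)
  also have "\<dots> = O3 (\<lambda>i j k. w i j k * T)"
    by (simp add: O3_def sum_distrib_right)
  also have "\<dots> = O3 (\<lambda>i j k. w i j k * T3 (U i j k))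
      + 3 * O3 (\<lambda>i j k. w i j k * T2 i (U i j k)) + 3 * O3 (\<lambda>i j k. w i j k * T2 j (U i j k))
      + 3 * O3 (\<lambda>i j k. w i j k * T2 k (U i j k))
      + 6 * O3 (\<lambda>i j k. w i j k * T1 i j (U i j k)) + 6 * O3 (\<lambda>i j k. w i j k * T1 i k (U i j k))
      + 6 * O3 (\<lambda>i j k. w i j k * T1 j k (U i j k))
      + 6 * O3 (\<lambda>i j k. (w i j k)\<^sup>2)"
    by (simp add: O3_def T sum.distrib sum_distrib_left)
  \<comment> \<open>Relabelling makes the three single overlaps equal (3 * 3 = 9) and likewise the
    three double overlaps (3 * 6 = 18).\<close>
  also have "O3 (\<lambda>i j k. w i j k * T2 k (U i j k)) = O3 (\<lambda>i j k. w i j k * T2 j (U i j k))"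
    by (subst swap23) (simp add: sym(2)[symmetric] U_commute(2)[symmetric])
  also have "O3 (\<lambda>i j k. w i j k * T2 j (U i j k)) = O3 (\<lambda>i j k. w i j k * T2 i (U i j k))"
    by (subst swap12) (simp add: sym(1)[symmetric] U_commute(1)[symmetric])
  also have "O3 (\<lambda>i j k. w i j k * T1 j k (U i j k)) = O3 (\<lambda>i j k. w i j k * T1 i k (U i j k))"
    by (subst swap12) (simp add: sym(1)[symmetric] U_commute(1)[symmetric])
  also have "O3 (\<lambda>i j k. w i j k * T1 i k (U i j k)) = O3 (\<lambda>i j k. w i j k * T1 i j (U i j k))"
    by (subst swap23) (simp add: sym(2)[symmetric] U_commute(2)[symmetric])
  finally have "(\<Sum>i\<in>A. \<Sum>j\<in>A - {i}. \<Sum>k\<in>A - {i} - {j}. w i j k)\<^sup>2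
      = O3 (\<lambda>i j k. w i j k * T3 (U i j k)) + 9 * O3 (\<lambda>i j k. w i j k * T2 i (U i j k))
      + 18 * O3 (\<lambda>i j k. w i j k * T1 i j (U i j k)) + 6 * O3 (\<lambda>i j k. (w i j k)\<^sup>2)"
    by simp
  \<comment> \<open>Back to distinct indices: repeated ones contribute zero, and symmetry moves the
    shared indices to the end, where the stated sums have them.\<close>
  moreover have "(\<Sum>a\<in>V. \<Sum>b\<in>V - {a}. \<Sum>c\<in>V - {a} - {b}. w a b c) = T3 V"
    "(\<Sum>a\<in>V. \<Sum>b\<in>V - {a}. w a b i) = T2 i V" if "finite V" for V i
    using that by (simp_all only: T3_def T2_def off1 off2 rot(1)[of _ _ i] off1')
  moreover have "(\<Sum>a\<in>V. w a j i) = T1 i j V" for V i j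
    by (simp only: T1_def rot(2)[of _ j i])
  ultimately show ?thesis
    using finU by (simp add: O3_def U_def flip: sum_distrib_left)
qed

subsection \<open>Measurability and moments\<close>

text \<open>A projection of a closed set is closed when the fibres are bounded locally uniformly.
  Along a convergent sequence of parameters the continuous \<open>R\<close> is bounded, so the
  witnesses have a convergent subsequence (Bolzano-Weierstrass).\<close>

lemma closed_Collect_ex_bounded:
  fixes P :: "'a::metric_space \<Rightarrow> 'b::euclidean_space \<Rightarrow> bool"
  assumes closed: "closed {(p, x). P p x}"
    and R: "continuous_on UNIV R" "\<And>p x. P p x \<Longrightarrow> norm x \<le> R p"
  shows "closed {p. \<exists>x. P p x}"
  unfolding closed_sequential_limits
proof (intro allI impI, elim conjE)
  fix p l assume "\<forall>n. p n \<in> {p. \<exists>x. P p x}" and lim: "p \<longlonglongrightarrow> l"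
  then obtain x where x: "P (p n) (x n)" for n by simp metis
  have "(\<lambda>n. R (p n)) \<longlonglongrightarrow> R l"
    using R(1) lim by (simp add: continuous_on_eq_continuous_at isCont_tendsto_compose)
  then have "Bseq (\<lambda>n. R (p n))" by (intro convergent_imp_Bseq convergentI)
  then obtain K where K: "norm (R (p n)) \<le> K" for n by (auto simp: Bseq_def)
  have "norm (x n) \<le> K" for n using R(2)[OF x[of n]] K[of n] by simp
  then have "bounded (range x)" by (auto simp: bounded_iff)
  then obtain z r where r: "strict_mono (r :: nat \<Rightarrow> nat)" "(x \<circ> r) \<longlonglongrightarrow> z"
    using bounded_imp_convergent_subsequence by blast
  have "(\<lambda>n. ((p \<circ> r) n, (x \<circ> r) n)) \<longlonglongrightarrow> (l, z)"
    by (rule tendsto_Pair[OF LIMSEQ_subseq_LIMSEQ[OF lim r(1)] r(2)])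
  then have "(l, z) \<in> {(p, x). P p x}"
    by (rule closed_sequentially[OF closed, rotated]) (simp add: x)
  then show "l \<in> {p. \<exists>x. P p x}" by auto
qed

lemma closed_Collect_mem_disc:
  fixes f :: "'a::topological_space \<Rightarrow> real^3" and g :: "'a \<Rightarrow> plate"
  assumes [continuous_intros]: "continuous_on UNIV f" "continuous_on UNIV g"
  shows "closed {p. f p \<in> disc (g p)}"
proof -
  have "{p. f p \<in> disc (g p)} = {p. dist (f p) (fst (g p)) \<le> fst (snd (g p)) \<and>
      (f p - fst (g p)) \<bullet> snd (snd (g p)) = 0}"
    by (auto simp: disc_def split_def)
  also have "closed \<dots>"
    by (intro closed_Collect_conj closed_Collect_le closed_Collect_eq continuous_intros)
  finally show ?thesis .
qed

lemma norm_le_of_mem_disc: "x \<in> disc s \<Longrightarrow> norm x \<le> norm (fst s) + fst (snd s)"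
  by (auto simp: disc_def dist_norm) (smt (verit) norm_triangle_sub)

lemma compact_disc: "compact (disc s)"
proof -
  have "closed (disc s)"
    using closed_Collect_mem_disc[of "\<lambda>x. x" "\<lambda>_. s"] by (simp add: continuous_on_id)
  then show ?thesis
    using norm_le_of_mem_disc[of _ s] by (metis boundedI compact_eq_bounded_closed)
qed

lemma borel_measurable_meet3:
  "(\<lambda>p. meet3 (fst p) (fst (snd p)) (snd (snd p))) \<in> borel_measurable borel"
proof -
  have "closed {p::plate \<times> plate \<times> plate. \<exists>x. x \<in> disc (fst p) \<and> x \<in> disc (fst (snd p)) \<and> x \<in> disc (snd (snd p))}"
  \<comment> \<open>A common point lies in the first disc, whose centre and radius already bound
    it.\<close>
  proof (rule closed_Collect_ex_bounded[where R = "\<lambda>p. norm (fst (fst p)) + fst (snd (fst p))"])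
    show "closed {(p::plate \<times> plate \<times> plate, x). x \<in> disc (fst p) \<and> x \<in> disc (fst (snd p)) \<and> x \<in> disc (snd (snd p))}"
      unfolding split_def
      by (intro closed_Collect_conj closed_Collect_mem_disc continuous_intros)
    show "continuous_on UNIV (\<lambda>p::plate \<times> plate \<times> plate. norm (fst (fst p)) + fst (snd (fst p)))"
      by (intro continuous_intros)
  qed (use norm_le_of_mem_disc in blast)
  then have [measurable]: "{p::plate \<times> plate \<times> plate. \<exists>x. x \<in> disc (fst p) \<and> x \<in> disc (fst (snd p)) \<and> x \<in> disc (snd (snd p))} \<in> sets borel"
    by (rule borel_closed)
  have "(\<lambda>p. meet3 (fst p) (fst (snd p)) (snd (snd p)))
     = (indicator {p. \<exists>x. x \<in> disc (fst p) \<and> x \<in> disc (fst (snd p)) \<and> x \<in> disc (snd (snd p))} :: _ \<Rightarrow> real)"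
    by (auto simp: meet3_def fun_eq_iff indicator_def)
  then show ?thesis by simp
qed

lemma ilen_nonneg: "0 \<le> ilen s t"
  unfolding ilen_def by (intro diameter_ge_0 compact_imp_bounded compact_Int compact_disc)

text \<open>The diameter of a compact nonempty set is attained; \<open>0 < c\<close> excludes the
  empty intersection, whose diameter is 0. The two points form one variable \<open>p\<close> to fit
  the projection lemma.\<close>

lemma le_ilen_iff:
  assumes "0 < c"
  shows "c \<le> ilen s t \<longleftrightarrow> (\<exists>p. fst p \<in> disc s \<and> fst p \<in> disc t \<and> snd p \<in> disc s \<and> snd p \<in> disc t
    \<and> c \<le> dist (fst p) (snd p))"
proof
  assume c: "c \<le> ilen s t"
  have "disc s \<inter> disc t \<noteq> {}" using c assms by (auto simp: ilen_def diameter_def)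
  from diameter_compact_attained[OF compact_Int[OF compact_disc compact_disc] this]
  obtain x y where "x \<in> disc s \<inter> disc t" "y \<in> disc s \<inter> disc t" "dist x y = ilen s t"
    by (auto simp: ilen_def)
  then show "\<exists>p. fst p \<in> disc s \<and> fst p \<in> disc t \<and> snd p \<in> disc s \<and> snd p \<in> disc t
      \<and> c \<le> dist (fst p) (snd p)"
    using c by (intro exI[of _ "(x, y)"]) auto
next
  assume "\<exists>p. fst p \<in> disc s \<and> fst p \<in> disc t \<and> snd p \<in> disc s \<and> snd p \<in> disc t
    \<and> c \<le> dist (fst p) (snd p)"
  moreover have "bounded (disc s \<inter> disc t)"
    by (intro compact_imp_bounded compact_Int compact_disc)
  ultimately show "c \<le> ilen s t"
    unfolding ilen_def by (meson IntI diameter_bounded_bound order_trans)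
qed

text \<open>Upper semicontinuity: superlevel sets at positive levels are projections of closed sets,
  at other levels they are the whole space.\<close>

lemma borel_measurable_ilen: "(\<lambda>p. ilen (fst p) (snd p)) \<in> borel_measurable borel"
proof (rule borel_measurableI_ge)
  fix c :: real
  have "closed {p. c \<le> ilen (fst p) (snd p)}"
  proof (cases "0 < c")
    case True
    have "closed {p::plate \<times> plate. \<exists>q. fst q \<in> disc (fst p) \<and> fst q \<in> disc (snd p) \<and>
        snd q \<in> disc (fst p) \<and> snd q \<in> disc (snd p) \<and> c \<le> dist (fst q) (snd q)}"
    \<comment> \<open>The witness is a pair of points of the first disc, and the norm of a pair is
      at most the sum of the two norms.\<close>
    proof (rule closed_Collect_ex_bounded[where R = "\<lambda>p. 2 * (norm (fst (fst p)) + fst (snd (fst p)))"])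
      show "closed {(p::plate \<times> plate, q). fst q \<in> disc (fst p) \<and> fst q \<in> disc (snd p) \<and>
        snd q \<in> disc (fst p) \<and> snd q \<in> disc (snd p) \<and> c \<le> dist (fst q) (snd q)}"
        unfolding split_def
        by (intro closed_Collect_conj closed_Collect_mem_disc closed_Collect_le continuous_intros)
      show "norm q \<le> 2 * (norm (fst (fst p)) + fst (snd (fst p)))"
        if "fst q \<in> disc (fst p) \<and> fst q \<in> disc (snd p) \<and>
        snd q \<in> disc (fst p) \<and> snd q \<in> disc (snd p) \<and> c \<le> dist (fst q) (snd q)" for p :: "plate \<times> plate" and q
        using that norm_le_of_mem_disc[of "fst q" "fst p"] norm_le_of_mem_disc[of "snd q" "fst p"]
          norm_Pair_le[of "fst q" "snd q"] by simp
    qed (intro continuous_intros)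
    then show ?thesis by (simp add: le_ilen_iff[OF True])
  next
    case False
    then have "{p. c \<le> ilen (fst p) (snd p)} = UNIV"
      using ilen_nonneg by (auto intro: order_trans[of c 0])
    then show ?thesis by simp
  qed
  then show "{p \<in> space borel. c \<le> ilen (fst p) (snd p)} \<in> sets borel"
    by (auto intro: borel_closed)
qed

lemma measurable_ilen [measurable]:
  assumes [measurable]: "f \<in> borel_measurable M" "g \<in> borel_measurable M"
  shows "(\<lambda>z. ilen (f z) (g z)) \<in> borel_measurable M"
  using measurable_compose[OF borel_measurable_Pair[OF assms] borel_measurable_ilen] by simp

lemma measurable_meet3 [measurable]:
  assumes [measurable]: "f \<in> borel_measurable M" "g \<in> borel_measurable M" "h \<in> borel_measurable M"
  shows "(\<lambda>z. meet3 (f z) (g z) (h z)) \<in> borel_measurable M"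
  using measurable_compose[OF borel_measurable_Pair[OF assms(1) borel_measurable_Pair[OF assms(2,3)]]
      borel_measurable_meet3] by simp

lemma measurable_area [measurable]:
  assumes "f \<in> borel_measurable M"
  shows "(\<lambda>z. area (f z)) \<in> borel_measurable M"
proof -
  have "area \<in> borel_measurable borel"
    unfolding area_def by (intro borel_measurable_continuous_onI continuous_intros)
  then show ?thesis using assms by (rule measurable_compose[rotated])
qed

section \<open>Moments of the plate process for a general intensity measure\<close>

lemma meet3_nonneg: "0 \<le> meet3 s t u"
  by (simp add: meet3_def)

lemma area_nonneg: "0 \<le> area s"
  by (simp add: area_def)

text \<open>Sigma-finiteness serves the Tonelli arguments on products; the Borel sigma-algebra makes
  coordinates, and with them the geometric kernels, measurable.\<close>

locale plate_process =
  fixes lam :: "plate measure"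
  assumes sigma_finite_lam: "sigma_finite_measure lam"
    and sets_lam: "sets lam = sets borel"
begin

abbreviation P :: "nat \<Rightarrow> (nat \<Rightarrow> plate) measure" where
  "P n \<equiv> PiM {..<n} (\<lambda>_. lam)"

lemma measurable_coord [measurable]: "i < n \<Longrightarrow> (\<lambda>y. y i) \<in> borel_measurable (P n)"
  by (subst measurable_cong_sets[OF refl sets_lam[symmetric]]) (simp add: measurable_component_singleton)

lemma measurable_dsum:
  fixes g :: "plate list \<Rightarrow> real"
  assumes "(\<lambda>y. g (map y [0..<m])) \<in> borel_measurable (P m)"
  shows "(\<lambda>y. dsum m g (map y [0..<n])) \<in> borel_measurable (P n)"
  unfolding dsum_map_upt by (intro borel_measurable_sum measurable_map_dlists[where g = g, OF assms])

lemma measurable_hamil: "(\<lambda>y. hamil nu1 nu2 nu3 (map y [0..<n])) \<in> borel_measurable (P n)"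
  unfolding hamil_def S_cfg_eq_dsum L_cfg_eq_dsum N_cfg_eq_dsum
  by (intro borel_measurable_add borel_measurable_times borel_measurable_const measurable_dsum)
     (simp_all, measurable)

text \<open>The Mecke formula with \<open>h\<close> the normalised density. Division by
  \<open>cnu\<close> is multiplication by a fixed inverse, so it stays with the unmarked
  configuration while \<open>Ecal\<close> splits off.\<close>

lemma gibbs_exp_dsum:
  fixes g :: "plate list \<Rightarrow> real"
  assumes g: "(\<lambda>y. g (map y [0..<m])) \<in> borel_measurable (P m)" and nonneg: "\<And>ys. 0 \<le> g ys"
  shows "gibbs_exp lam nu1 nu2 nu3 (\<lambda>x. ennreal (dsum m g x)) = Eint lam nu1 nu2 nu3 m (\<lambda>y. g (map y [0..<m]))"
proof -
  define h where "h x = ennreal (exp (hamil nu1 nu2 nu3 x)) / cnu lam nu1 nu2 nu3" for x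
  have "ennreal (dsum m g x) = dsum m (\<lambda>ys. ennreal (g ys)) x" for x
    using nonneg by (simp add: dsum_def)
  moreover have "h (ys @ x) = ennreal (exp (hamil nu1 nu2 nu3 x)) / cnu lam nu1 nu2 nu3
      * ennreal (Ecal nu1 nu2 nu3 x ys)" for ys x
    by (simp add: h_def exp_hamil_append ennreal_mult Ecal_def Let_def divide_ennreal_def ac_simps)
  moreover have "pp_exp lam (\<lambda>x. h x * dsum m (\<lambda>ys. ennreal (g ys)) x)
     = (\<integral>\<^sup>+ y. pp_exp lam (\<lambda>x. h (map y [0..<m] @ x)) * ennreal (g (map y [0..<m])) \<partial>P m)"
  proof (rule pp_exp_Mecke[OF sigma_finite_lam])
    show "(\<lambda>y. h (map y [0..<n])) \<in> borel_measurable (P n)" for n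
      unfolding h_def using measurable_hamil by measurable
    show "h xs = h ys" if "mset xs = mset ys" for xs ys
      using hamil_mset_cong[OF that] by (simp add: h_def)
  qed (use g in measurable)
  ultimately show ?thesis
    by (simp add: gibbs_exp_def Eint_def flip: h_def)
qed

lemma gibbs_exp_add:
  assumes [measurable]: "\<And>n. (\<lambda>y. F (map y [0..<n])) \<in> borel_measurable (P n)"
    "\<And>n. (\<lambda>y. G (map y [0..<n])) \<in> borel_measurable (P n)"
  shows "gibbs_exp lam nu1 nu2 nu3 (\<lambda>x. F x + G x)
     = gibbs_exp lam nu1 nu2 nu3 F + gibbs_exp lam nu1 nu2 nu3 G"
proof -
  note measurable_hamil [measurable]
  show ?thesis
    unfolding gibbs_exp_def pp_exp_def distrib_left
    by (simp add: nn_integral_add distrib_left summableI flip: suminf_add)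
qed

lemma gibbs_exp_cmult:
  assumes [measurable]: "\<And>n. (\<lambda>y. F (map y [0..<n])) \<in> borel_measurable (P n)"
  shows "gibbs_exp lam nu1 nu2 nu3 (\<lambda>x. c * F x) = c * gibbs_exp lam nu1 nu2 nu3 F"
proof -
  note measurable_hamil [measurable]
  show ?thesis
    unfolding gibbs_exp_def pp_exp_def mult.left_commute[of _ c]
    by (simp add: nn_integral_cmult mult.left_commute[of _ c])
qed

end

section \<open>The squares of S, L and N as sums over distinct plates\<close>

lemma S_cfg_square: "(S_cfg x)\<^sup>2 = dsum 2 (\<lambda>ys. area (ys ! 0) * area (ys ! 1)) x + dsum 1 (\<lambda>ys. (area (ys ! 0))\<^sup>2) x"
proof -
  define A where "A = {..<length x}"
  have A: "finite A" by (simp add: A_def)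
  have "(S_cfg x)\<^sup>2 = (\<Sum>i\<in>A. \<Sum>j\<in>A. area (x ! i) * area (x ! j))"
    by (simp add: S_cfg_def power2_eq_square sum_product A_def)
  also have "\<dots> = (\<Sum>i\<in>A. area (x ! i) * area (x ! i) + (\<Sum>j\<in>A - {i}. area (x ! i) * area (x ! j)))"
    using A by (intro sum.cong refl sum.remove)
  finally show ?thesis
    by (simp add: dsum_def sum_dlists_Suc numeral_eq_Suc sum.distrib power2_eq_square A_def)
qed

text \<open>The weights are (1/2)^2 times 1, 4, 2.\<close>

lemma L_cfg_square: "(L_cfg x)\<^sup>2 = 1/4 * dsum 4 (\<lambda>ys. ilen (ys ! 0) (ys ! 1) * ilen (ys ! 2) (ys ! 3)) x
   + dsum 3 (\<lambda>ys. ilen (ys ! 0) (ys ! 1) * ilen (ys ! 2) (ys ! 0)) x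
   + 1/2 * dsum 2 (\<lambda>ys. (ilen (ys ! 0) (ys ! 1))\<^sup>2) x"
proof -
  \<comment> \<open>The zero on the diagonal is imposed by hand, since a disc meets itself in a set
    of diameter generally positive.\<close>
  define w where "w i j = (if i = j then 0 else ilen (x ! i) (x ! j))" for i j
  define A where "A = {..<length x}"
  have A: "finite A" by (simp add: A_def)
  have "dsum 2 (\<lambda>ys. ilen (ys ! 0) (ys ! 1)) x = (\<Sum>i\<in>A. \<Sum>j\<in>A - {i}. w i j)"
    "dsum 4 (\<lambda>ys. ilen (ys ! 0) (ys ! 1) * ilen (ys ! 2) (ys ! 3)) x
      = (\<Sum>i\<in>A. \<Sum>j\<in>A - {i}. \<Sum>k\<in>A - {i} - {j}. \<Sum>l\<in>A - {i} - {j} - {k}. w i j * w k l)"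
    "dsum 3 (\<lambda>ys. ilen (ys ! 0) (ys ! 1) * ilen (ys ! 2) (ys ! 0)) x
      = (\<Sum>i\<in>A. \<Sum>j\<in>A - {i}. \<Sum>k\<in>A - {i} - {j}. w i j * w k i)"
    "dsum 2 (\<lambda>ys. (ilen (ys ! 0) (ys ! 1))\<^sup>2) x = (\<Sum>i\<in>A. \<Sum>j\<in>A - {i}. (w i j)\<^sup>2)"
    by (auto simp: dsum_def sum_dlists_Suc numeral_eq_Suc w_def A_def intro!: sum.cong)
  moreover have "w i j = w j i" "w i i = 0" for i j
    using ilen_commute by (auto simp: w_def)
  ultimately show ?thesis
    using square_sum2[OF A, of w] by (simp add: L_cfg_eq_dsum power_mult_distrib power_divide)
qed

text \<open>The weights are (1/6)^2 times 1, 9, 18, 6; the square in the last term disappears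
  because \<open>meet3\<close> takes only the values 0 and 1.\<close>

lemma N_cfg_square: "(N_cfg x)\<^sup>2 =
     1/36 * dsum 6 (\<lambda>ys. meet3 (ys ! 0) (ys ! 1) (ys ! 2) * meet3 (ys ! 3) (ys ! 4) (ys ! 5)) x
   + 1/4 * dsum 5 (\<lambda>ys. meet3 (ys ! 0) (ys ! 1) (ys ! 2) * meet3 (ys ! 3) (ys ! 4) (ys ! 0)) x
   + 1/2 * dsum 4 (\<lambda>ys. meet3 (ys ! 0) (ys ! 1) (ys ! 2) * meet3 (ys ! 3) (ys ! 1) (ys ! 0)) x
   + 1/6 * dsum 3 (\<lambda>ys. meet3 (ys ! 0) (ys ! 1) (ys ! 2)) x"
proof -
  define w where "w i j k = (if i = j \<or> i = k \<or> j = k then 0 else meet3 (x ! i) (x ! j) (x ! k))" for i j k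
  define A where "A = {..<length x}"
  have A: "finite A" by (simp add: A_def)
  have "(w i j k)\<^sup>2 = w i j k" for i j k by (simp add: w_def meet3_def)
  moreover have "dsum 3 (\<lambda>ys. meet3 (ys ! 0) (ys ! 1) (ys ! 2)) x = (\<Sum>i\<in>A. \<Sum>j\<in>A - {i}. \<Sum>k\<in>A - {i} - {j}. w i j k)"
    "dsum 4 (\<lambda>ys. meet3 (ys ! 0) (ys ! 1) (ys ! 2) * meet3 (ys ! 3) (ys ! 1) (ys ! 0)) x
      = (\<Sum>i\<in>A. \<Sum>j\<in>A - {i}. \<Sum>k\<in>A - {i} - {j}. \<Sum>a\<in>A - {i} - {j} - {k}. w i j k * w a j i)"
    "dsum 5 (\<lambda>ys. meet3 (ys ! 0) (ys ! 1) (ys ! 2) * meet3 (ys ! 3) (ys ! 4) (ys ! 0)) x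
      = (\<Sum>i\<in>A. \<Sum>j\<in>A - {i}. \<Sum>k\<in>A - {i} - {j}. \<Sum>a\<in>A - {i} - {j} - {k}. \<Sum>b\<in>A - {i} - {j} - {k} - {a}.
          w i j k * w a b i)"
    "dsum 6 (\<lambda>ys. meet3 (ys ! 0) (ys ! 1) (ys ! 2) * meet3 (ys ! 3) (ys ! 4) (ys ! 5)) x
      = (\<Sum>i\<in>A. \<Sum>j\<in>A - {i}. \<Sum>k\<in>A - {i} - {j}. \<Sum>a\<in>A - {i} - {j} - {k}. \<Sum>b\<in>A - {i} - {j} - {k} - {a}.
          \<Sum>c\<in>A - {i} - {j} - {k} - {a} - {b}. w i j k * w a b c)"
    by (auto simp: dsum_def sum_dlists_Suc numeral_eq_Suc w_def A_def intro!: sum.cong)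
  moreover have "w i j k = w j i k" "w i j k = w i k j" "w i i k = 0" for i j k
    using meet3_commute by (auto simp: w_def)
  ultimately show ?thesis
    using square_sum3[OF A, of w] by (simp add: N_cfg_eq_dsum power_mult_distrib power_divide)
qed

lemma dsum_nonneg: "(\<And>ys. 0 \<le> g ys) \<Longrightarrow> 0 \<le> (dsum m g x :: real)"
  by (simp add: dsum_def sum_nonneg)

context plate_process
begin

text \<open>Ties the list form of a kernel, which \<open>dsum\<close> takes, to its coordinate form,
  which \<open>Eint\<close> takes, and bundles the side conditions of the Mecke formula.\<close>

definition kernel :: "nat \<Rightarrow> (plate list \<Rightarrow> real) \<Rightarrow> ((nat \<Rightarrow> plate) \<Rightarrow> real) \<Rightarrow> bool" where
  "kernel m g k \<longleftrightarrow> (\<forall>y. g (map y [0..<m]) = k y) \<and> k \<in> borel_measurable (P m) \<and> (\<forall>ys. 0 \<le> g ys)"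

lemma kernel_measurable_dsum:
  assumes "kernel m g k"
  shows "(\<lambda>y. c * dsum m g (map y [0..<n])) \<in> borel_measurable (P n)"
  using assms by (intro borel_measurable_times borel_measurable_const measurable_dsum) (simp add: kernel_def)

lemma gibbs_exp_cmult_dsum:
  assumes "kernel m g k" and "0 \<le> c"
  shows "gibbs_exp lam nu1 nu2 nu3 (\<lambda>x. ennreal (c * dsum m g x)) = ennreal c * Eint lam nu1 nu2 nu3 m k"
proof -
  have g: "(\<lambda>y. g (map y [0..<m])) \<in> borel_measurable (P m)" "\<And>ys. 0 \<le> g ys"
    using assms(1) by (simp_all add: kernel_def)
  have "gibbs_exp lam nu1 nu2 nu3 (\<lambda>x. ennreal (c * dsum m g x))
      = gibbs_exp lam nu1 nu2 nu3 (\<lambda>x. ennreal c * ennreal (dsum m g x))"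
    using assms(2) g(2) by (simp add: ennreal_mult dsum_nonneg)
  also have "\<dots> = ennreal c * gibbs_exp lam nu1 nu2 nu3 (\<lambda>x. ennreal (dsum m g x))"
    by (intro gibbs_exp_cmult measurable_compose[OF measurable_dsum[OF g(1)] measurable_ennreal])
  also have "gibbs_exp lam nu1 nu2 nu3 (\<lambda>x. ennreal (dsum m g x)) = Eint lam nu1 nu2 nu3 m k"
    using gibbs_exp_dsum[OF g] assms(1) by (simp add: kernel_def)
  finally show ?thesis .
qed

text \<open>Peels the last summand off a linear combination, with \<open>F\<close> the sum of the
  earlier ones. Nonnegativity of both parts is what lets \<open>ennreal\<close> distribute over the
  real sum.\<close>

lemma gibbs_exp_add_cmult_dsum:
  assumes "kernel m g k" and "0 \<le> c"
    and "\<And>n. (\<lambda>y. F (map y [0..<n])) \<in> borel_measurable (P n)" and "\<And>x. 0 \<le> F x"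
  shows "gibbs_exp lam nu1 nu2 nu3 (\<lambda>x. ennreal (F x + c * dsum m g x))
     = gibbs_exp lam nu1 nu2 nu3 (\<lambda>x. ennreal (F x)) + ennreal c * Eint lam nu1 nu2 nu3 m k"
proof -
  have "gibbs_exp lam nu1 nu2 nu3 (\<lambda>x. ennreal (F x + c * dsum m g x))
      = gibbs_exp lam nu1 nu2 nu3 (\<lambda>x. ennreal (F x) + ennreal (c * dsum m g x))"
    using assms by (simp add: dsum_nonneg kernel_def)
  also have "\<dots> = gibbs_exp lam nu1 nu2 nu3 (\<lambda>x. ennreal (F x)) + gibbs_exp lam nu1 nu2 nu3 (\<lambda>x. ennreal (c * dsum m g x))"
    by (intro gibbs_exp_add measurable_compose[OF assms(3) measurable_ennreal]
        measurable_compose[OF kernel_measurable_dsum[OF assms(1)] measurable_ennreal])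
  finally show ?thesis using assms(1,2) by (simp add: gibbs_exp_cmult_dsum)
qed

lemma kernel_dsum_nonneg: "kernel m g k \<Longrightarrow> 0 \<le> c \<Longrightarrow> 0 \<le> c * dsum m g x"
  by (simp add: kernel_def dsum_nonneg)

lemma exp_S: "gibbs_exp lam nu1 nu2 nu3 (\<lambda>x. ennreal (S_cfg x)) = Eint lam nu1 nu2 nu3 1 (\<lambda>y. area (y 0))"
proof -
  have "kernel 1 (\<lambda>ys. area (ys ! 0)) (\<lambda>y. area (y 0))"
    by (simp add: kernel_def area_nonneg, measurable)
  from gibbs_exp_cmult_dsum[OF this, of 1] show ?thesis by (simp add: S_cfg_eq_dsum)
qed

lemma exp_L: "gibbs_exp lam nu1 nu2 nu3 (\<lambda>x. ennreal (L_cfg x))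
    = ennreal (1/2) * Eint lam nu1 nu2 nu3 2 (\<lambda>y. ilen (y 0) (y 1))"
proof -
  have "kernel 2 (\<lambda>ys. ilen (ys ! 0) (ys ! 1)) (\<lambda>y. ilen (y 0) (y 1))"
    by (simp add: kernel_def ilen_nonneg, measurable)
  from gibbs_exp_cmult_dsum[OF this, of "1/2"] show ?thesis by (simp add: L_cfg_eq_dsum)
qed

lemma kernel_meet3: "kernel 3 (\<lambda>ys. meet3 (ys ! 0) (ys ! 1) (ys ! 2)) (\<lambda>y. meet3 (y 0) (y 1) (y 2))"
  unfolding kernel_def by (intro conjI) (simp add: numeral_eq_Suc, measurable, simp add: meet3_nonneg)

lemma exp_N: "gibbs_exp lam nu1 nu2 nu3 (\<lambda>x. ennreal (N_cfg x))
    = ennreal (1/6) * Eint lam nu1 nu2 nu3 3 (\<lambda>y. meet3 (y 0) (y 1) (y 2))"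
  using gibbs_exp_cmult_dsum[OF kernel_meet3, of "1/6"] by (simp add: N_cfg_eq_dsum)

lemma exp_S_square: "gibbs_exp lam nu1 nu2 nu3 (\<lambda>x. ennreal ((S_cfg x)\<^sup>2))
    = Eint lam nu1 nu2 nu3 2 (\<lambda>y. area (y 0) * area (y 1)) + Eint lam nu1 nu2 nu3 1 (\<lambda>y. (area (y 0))\<^sup>2)"
proof -
  have k2: "kernel 2 (\<lambda>ys. area (ys ! 0) * area (ys ! 1)) (\<lambda>y. area (y 0) * area (y 1))"
    unfolding kernel_def by (intro conjI) (simp add: numeral_eq_Suc, measurable, simp add: area_nonneg)
  have k1: "kernel 1 (\<lambda>ys. (area (ys ! 0))\<^sup>2) (\<lambda>y. (area (y 0))\<^sup>2)"
    unfolding kernel_def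
    by (intro conjI borel_measurable_power measurable_area measurable_coord) simp_all
  \<comment> \<open>Factors 1 give every summand the shape \<open>c * dsum m g x\<close> that the
    peeling lemma matches.\<close>
  have "(S_cfg x)\<^sup>2 = 1 * dsum 2 (\<lambda>ys. area (ys ! 0) * area (ys ! 1)) x + 1 * dsum 1 (\<lambda>ys. (area (ys ! 0))\<^sup>2) x" for x
    by (simp add: S_cfg_square)
  then have "gibbs_exp lam nu1 nu2 nu3 (\<lambda>x. ennreal ((S_cfg x)\<^sup>2))
    = ennreal 1 * Eint lam nu1 nu2 nu3 2 (\<lambda>y. area (y 0) * area (y 1))
    + ennreal 1 * Eint lam nu1 nu2 nu3 1 (\<lambda>y. (area (y 0))\<^sup>2)"
    by (simp only: gibbs_exp_add_cmult_dsum[OF k1 zero_le_one kernel_measurable_dsum[OF k2] kernel_dsum_nonneg[OF k2 zero_le_one]]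
      gibbs_exp_cmult_dsum[OF k2 zero_le_one])
  then show ?thesis by simp
qed

lemma exp_L_square: "gibbs_exp lam nu1 nu2 nu3 (\<lambda>x. ennreal ((L_cfg x)\<^sup>2))
      = ennreal (1/4) * Eint lam nu1 nu2 nu3 4 (\<lambda>y. ilen (y 0) (y 1) * ilen (y 2) (y 3))
      + Eint lam nu1 nu2 nu3 3 (\<lambda>y. ilen (y 0) (y 1) * ilen (y 2) (y 0))
      + ennreal (1/2) * Eint lam nu1 nu2 nu3 2 (\<lambda>y. (ilen (y 0) (y 1))\<^sup>2)"
proof -
  have k4: "kernel 4 (\<lambda>ys. ilen (ys ! 0) (ys ! 1) * ilen (ys ! 2) (ys ! 3)) (\<lambda>y. ilen (y 0) (y 1) * ilen (y 2) (y 3))"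
    unfolding kernel_def by (intro conjI) (simp add: numeral_eq_Suc, measurable, simp add: ilen_nonneg)
  have k3: "kernel 3 (\<lambda>ys. ilen (ys ! 0) (ys ! 1) * ilen (ys ! 2) (ys ! 0)) (\<lambda>y. ilen (y 0) (y 1) * ilen (y 2) (y 0))"
    unfolding kernel_def by (intro conjI) (simp add: numeral_eq_Suc, measurable, simp add: ilen_nonneg)
  have k2: "kernel 2 (\<lambda>ys. (ilen (ys ! 0) (ys ! 1))\<^sup>2) (\<lambda>y. (ilen (y 0) (y 1))\<^sup>2)"
    unfolding kernel_def
    by (intro conjI borel_measurable_power measurable_ilen measurable_coord) simp_all
  have c: "(0::real) \<le> 1/4" "(0::real) \<le> 1" "(0::real) \<le> 1/2" by simp_all
  \<comment> \<open>Measurability and nonnegativity of the partial sums, which take the place of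
    \<open>F\<close> as summands are peeled off from the right.\<close>
  note m4 = kernel_measurable_dsum[OF k4, of "1/4"] and n4 = kernel_dsum_nonneg[OF k4 c(1)]
  note m3 = borel_measurable_add[OF m4 kernel_measurable_dsum[OF k3, of 1]]
    and n3 = add_nonneg_nonneg[OF n4 kernel_dsum_nonneg[OF k3 c(2)]]
  have "(L_cfg x)\<^sup>2 = 1/4 * dsum 4 (\<lambda>ys. ilen (ys ! 0) (ys ! 1) * ilen (ys ! 2) (ys ! 3)) x
     + 1 * dsum 3 (\<lambda>ys. ilen (ys ! 0) (ys ! 1) * ilen (ys ! 2) (ys ! 0)) x
     + 1/2 * dsum 2 (\<lambda>ys. (ilen (ys ! 0) (ys ! 1))\<^sup>2) x" for x
    by (simp add: L_cfg_square)
  then have "gibbs_exp lam nu1 nu2 nu3 (\<lambda>x. ennreal ((L_cfg x)\<^sup>2))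
      = ennreal (1/4) * Eint lam nu1 nu2 nu3 4 (\<lambda>y. ilen (y 0) (y 1) * ilen (y 2) (y 3))
      + ennreal 1 * Eint lam nu1 nu2 nu3 3 (\<lambda>y. ilen (y 0) (y 1) * ilen (y 2) (y 0))
      + ennreal (1/2) * Eint lam nu1 nu2 nu3 2 (\<lambda>y. (ilen (y 0) (y 1))\<^sup>2)"
    by (simp only: gibbs_exp_add_cmult_dsum[OF k2 c(3) m3 n3] gibbs_exp_add_cmult_dsum[OF k3 c(2) m4 n4]
        gibbs_exp_cmult_dsum[OF k4 c(1)])
  then show ?thesis by simp
qed

lemma exp_N_square: "gibbs_exp lam nu1 nu2 nu3 (\<lambda>x. ennreal ((N_cfg x)\<^sup>2))
      = ennreal (1/36) * Eint lam nu1 nu2 nu3 6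
          (\<lambda>y. meet3 (y 0) (y 1) (y 2) * meet3 (y 3) (y 4) (y 5))
      + ennreal (1/4) * Eint lam nu1 nu2 nu3 5
          (\<lambda>y. meet3 (y 0) (y 1) (y 2) * meet3 (y 3) (y 4) (y 0))
      + ennreal (1/2) * Eint lam nu1 nu2 nu3 4
          (\<lambda>y. meet3 (y 0) (y 1) (y 2) * meet3 (y 3) (y 1) (y 0))
      + ennreal (1/6) * Eint lam nu1 nu2 nu3 3 (\<lambda>y. meet3 (y 0) (y 1) (y 2))"
proof -
  have k6: "kernel 6 (\<lambda>ys. meet3 (ys ! 0) (ys ! 1) (ys ! 2) * meet3 (ys ! 3) (ys ! 4) (ys ! 5))
      (\<lambda>y. meet3 (y 0) (y 1) (y 2) * meet3 (y 3) (y 4) (y 5))"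
    unfolding kernel_def by (intro conjI) (simp add: numeral_eq_Suc, measurable, simp add: meet3_nonneg)
  have k5: "kernel 5 (\<lambda>ys. meet3 (ys ! 0) (ys ! 1) (ys ! 2) * meet3 (ys ! 3) (ys ! 4) (ys ! 0))
      (\<lambda>y. meet3 (y 0) (y 1) (y 2) * meet3 (y 3) (y 4) (y 0))"
    unfolding kernel_def by (intro conjI) (simp add: numeral_eq_Suc, measurable, simp add: meet3_nonneg)
  have k4: "kernel 4 (\<lambda>ys. meet3 (ys ! 0) (ys ! 1) (ys ! 2) * meet3 (ys ! 3) (ys ! 1) (ys ! 0))
      (\<lambda>y. meet3 (y 0) (y 1) (y 2) * meet3 (y 3) (y 1) (y 0))"
    unfolding kernel_def by (intro conjI) (simp add: numeral_eq_Suc, measurable, simp add: meet3_nonneg)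
  have c: "(0::real) \<le> 1/36" "(0::real) \<le> 1/4" "(0::real) \<le> 1/2" "(0::real) \<le> 1/6" by simp_all
  note m6 = kernel_measurable_dsum[OF k6, of "1/36"] and n6 = kernel_dsum_nonneg[OF k6 c(1)]
  note m5 = borel_measurable_add[OF m6 kernel_measurable_dsum[OF k5, of "1/4"]]
    and n5 = add_nonneg_nonneg[OF n6 kernel_dsum_nonneg[OF k5 c(2)]]
  note m4 = borel_measurable_add[OF m5 kernel_measurable_dsum[OF k4, of "1/2"]]
    and n4 = add_nonneg_nonneg[OF n5 kernel_dsum_nonneg[OF k4 c(3)]]
  show ?thesis
    unfolding N_cfg_square
    by (simp only: gibbs_exp_add_cmult_dsum[OF kernel_meet3 c(4) m4 n4] gibbs_exp_add_cmult_dsum[OF k4 c(3) m5 n5]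
        gibbs_exp_add_cmult_dsum[OF k5 c(2) m6 n6] gibbs_exp_cmult_dsum[OF k6 c(1)])
qed

end

section \<open>The intensity measure of the plate model\<close>

lemma sets_plate_intensity:
  assumes "sets Q = sets borel" "sets V = sets borel"
  shows "sets (plate_intensity B b rho Q V) = sets borel"
proof -
  have "sets (lborel \<Otimes>\<^sub>M (Q \<Otimes>\<^sub>M V)) = sets (borel \<Otimes>\<^sub>M (borel \<Otimes>\<^sub>M borel) :: plate measure)"
    using assms by (intro sets_pair_measure_cong) simp_all
  also have "\<dots> = sets borel" by (simp only: borel_prod)
  finally show ?thesis by (simp add: plate_intensity_def)
qed

text \<open>The density is dominated by \<open>C\<close> on the cylinder over \<open>B\<close>, and
  \<open>Q\<close> and \<open>V\<close> have mass 1, so the total mass is at most \<open>C\<close>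
  times the volume of the bounded set \<open>B\<close>.\<close>

lemma finite_measure_plate_intensity:
  assumes B: "B \<in> sets lborel" "bounded B" and rho: "rho \<in> borel_measurable borel" "\<forall>z\<in>B. rho z \<le> C"
    and Q: "prob_space Q" "sets Q = sets borel" and V: "prob_space V" "sets V = sets borel"
  shows "finite_measure (plate_intensity B b rho Q V)"
proof
  let ?M = "lborel \<Otimes>\<^sub>M (Q \<Otimes>\<^sub>M V)" and ?lam = "plate_intensity B b rho Q V"
  interpret Q: prob_space Q by fact
  interpret V: prob_space V by fact
  interpret QV: pair_prob_space Q V ..
  have spQ: "space Q = UNIV" "space V = UNIV" using sets_eq_imp_space_eq[OF Q(2)] sets_eq_imp_space_eq[OF V(2)] by simp_all
  \<comment> \<open>Gives measurability of \<open>plate_space B b\<close>, hence of the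
    density.\<close>
  have "closed hemi"
    unfolding hemi_def by (intro closed_Collect_conj closed_Collect_eq closed_Collect_le continuous_intros)
  then have "plate_space B b \<in> sets ?M"
    unfolding plate_space_def using B(1) Q(2) V(2) by (intro pair_measureI) auto
  then have f: "(\<lambda>(z, r, phi). indicator (plate_space B b) (z, r, phi) * ennreal (rho z)) \<in> borel_measurable ?M"
    using rho(1) by (simp add: split_def)
  have "emeasure ?lam (space ?lam) = (\<integral>\<^sup>+ p. (\<lambda>(z, r, phi). indicator (plate_space B b) (z, r, phi) * ennreal (rho z)) p \<partial>?M)"
    unfolding plate_intensity_def space_density
    by (subst emeasure_density[OF f sets.top]) (auto intro!: nn_integral_cong)
  also have "\<dots> \<le> (\<integral>\<^sup>+ p. ennreal C * indicator (B \<times> space (Q \<Otimes>\<^sub>M V)) p \<partial>?M)"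
    using rho(2) by (intro nn_integral_mono) (auto simp: space_pair_measure spQ plate_space_def indicator_def intro!: ennreal_leI)
  also have "\<dots> = ennreal C * emeasure ?M (B \<times> space (Q \<Otimes>\<^sub>M V))"
    by (intro nn_integral_cmult_indicator pair_measureI B(1) sets.top)
  also have "\<dots> = ennreal C * emeasure lborel B"
    using B(1) by (subst QV.emeasure_pair_measure_Times) (auto simp: QV.emeasure_space_1)
  also have "\<dots> < \<infinity>"
    using emeasure_bounded_finite[OF B(2)] by (simp add: ennreal_mult_less_top)
  finally show "emeasure ?lam (space ?lam) \<noteq> \<infinity>" by simp
qed

theorem theorem5:
  fixes B :: "(real^3) set" and b :: real and rho :: "real^3 \<Rightarrow> real"
    and Q :: "real measure" and V :: "(real^3) measure" and nu1 nu2 nu3 :: real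
  assumes "B \<in> sets lborel" and "bounded B" and "emeasure lborel B > 0" and "b > 0"
    and "rho \<in> borel_measurable borel" and "\<forall>z\<in>B. 0 \<le> rho z" and "\<exists>C. \<forall>z\<in>B. rho z \<le> C"
    and "prob_space Q" and "sets Q = sets borel" and "emeasure Q {0<..b} = 1"
    and "prob_space V" and "sets V = sets borel" and "emeasure V hemi = 1"
    and "nu2 \<le> 0" and "nu3 \<le> 0"
  defines "lam \<equiv> plate_intensity B b rho Q V"
  shows
   "(gibbs_exp lam nu1 nu2 nu3 (\<lambda>x. ennreal (S_cfg x))
      = Eint lam nu1 nu2 nu3 1 (\<lambda>y. area (y 0)))
    \<and> (gibbs_exp lam nu1 nu2 nu3 (\<lambda>x. ennreal (L_cfg x))
      = ennreal (1/2) * Eint lam nu1 nu2 nu3 2 (\<lambda>y. ilen (y 0) (y 1)))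
    \<and> (gibbs_exp lam nu1 nu2 nu3 (\<lambda>x. ennreal (N_cfg x))
      = ennreal (1/6) * Eint lam nu1 nu2 nu3 3 (\<lambda>y. meet3 (y 0) (y 1) (y 2)))
    \<and> (gibbs_exp lam nu1 nu2 nu3 (\<lambda>x. ennreal ((S_cfg x)^2))
      = Eint lam nu1 nu2 nu3 2 (\<lambda>y. area (y 0) * area (y 1))
      + Eint lam nu1 nu2 nu3 1 (\<lambda>y. (area (y 0))^2))
    \<and> (gibbs_exp lam nu1 nu2 nu3 (\<lambda>x. ennreal ((L_cfg x)^2))
      = ennreal (1/4) * Eint lam nu1 nu2 nu3 4 (\<lambda>y. ilen (y 0) (y 1) * ilen (y 2) (y 3))
      + Eint lam nu1 nu2 nu3 3 (\<lambda>y. ilen (y 0) (y 1) * ilen (y 2) (y 0))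
      + ennreal (1/2) * Eint lam nu1 nu2 nu3 2 (\<lambda>y. (ilen (y 0) (y 1))^2))
    \<and> (gibbs_exp lam nu1 nu2 nu3 (\<lambda>x. ennreal ((N_cfg x)^2))
      = ennreal (1/36) * Eint lam nu1 nu2 nu3 6
          (\<lambda>y. meet3 (y 0) (y 1) (y 2) * meet3 (y 3) (y 4) (y 5))
      + ennreal (1/4) * Eint lam nu1 nu2 nu3 5
          (\<lambda>y. meet3 (y 0) (y 1) (y 2) * meet3 (y 3) (y 4) (y 0))
      + ennreal (1/2) * Eint lam nu1 nu2 nu3 4
          (\<lambda>y. meet3 (y 0) (y 1) (y 2) * meet3 (y 3) (y 1) (y 0))
      + ennreal (1/6) * Eint lam nu1 nu2 nu3 3 (\<lambda>y. meet3 (y 0) (y 1) (y 2)))"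
proof -
  obtain C where C: "\<forall>z\<in>B. rho z \<le> C" using assms(7) by blast
  interpret plate_process lam
  proof (rule plate_process.intro)
    show "sigma_finite_measure lam"
      unfolding lam_def using finite_measure_plate_intensity[OF assms(1,2,5) C assms(8,9,11,12)]
      by (rule finite_measure.sigma_finite_measure)
    show "sets lam = sets borel"
      unfolding lam_def by (rule sets_plate_intensity[OF assms(9,12)])
  qed
  show ?thesis
    by (intro conjI exp_S exp_L exp_N exp_S_square exp_L_square exp_N_square)
qed

end
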